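(* Let $\varphi(x_1,\ldots,x_n)$ be a term in the language $\mathcal{L}_\lambda=\{+,-,\cdot,0,1\}\cup\{\lambda^k,\sigma^k,\psi_k\}_{k\ge1}$ with $\operatorname{depth}(\varphi)=(d_1,\ldots,d_n)$. Then there exist unique polynomials $$P_\varphi^\lambda,\ P_\varphi^\sigma\in\mathbb{Z}[x_{1,1},\ldots,x_{1,d_1},x_{2,1},\ldots,x_{2,d_2},\ldots,x_{n,1},\ldots,x_{n,d_n}]$$ such that for every model $(R,\lambda,\sigma,\psi)$ of $\mathcal{T}$ and all $r_1,\ldots,r_n\in R$, $$\varphi(r_1,\ldots,r_n)=P_\varphi^\lambda\bigl(\lambda^1(r_1),\ldots,\lambda^{d_1}(r_1),\lambda^1(r_2),\ldots,\lambda^{d_n}(r_n)\bigr)$$ and $$\varphi(r_1,\ldots,r_n)=P_\varphi^\sigma\bigl(\sigma^1(r_1),\ldots,\sigma^{d_1}(r_1),\sigma^1(r_2),\ldots,\sigma^{d_n}(r_n)\bigr).$$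
   Context: All rings are commutative with unit. **$\lambda$-rings.** A $\lambda$-ring structure on a ring $R$ is a family of maps $\lambda^i:R\to R$, $i\ge 0$ (not necessarily homomorphisms), with $\lambda^0(x)=1$, $\lambda^1(x)=x$ and $\lambda^n(x+y)=\sum_{i=0}^n\lambda^i(x)\lambda^{n-i}(y)$ for all $x,y\in R$, $n\ge 0$. Put $\lambda_t(x)=\sum_{i\ge 0}\lambda^i(x)t^i$. The opposite $\lambda$-ring structure $\sigma$ is defined by $\sigma_t(x)=\sum_{i\ge 0}\sigma^i(x)t^i=(\lambda_{-t}(x))^{-1}$. **Special.** Let $e_k$ denote elementary symmetric polynomials. Let $P_n$ and $P_{n,m}$ be the universal integral polynomials determined by $$P_n\bigl(e_1(X),\ldots,e_n(X),e_1(Y),\ldots,e_n(Y)\bigr)=\operatorname{coeff}_{t^n}\prod_{i,j=1}^n(1+tX_iY_j)$$ (with $X=(X_1,\ldots,X_n)$, $Y=(Y_1,\ldots,Y_n)$) and $$P_{n,m}\bigl(e_1(X),\ldots,e_{nm}(X)\bigr)=\operatorname{coeff}_{t^n}\prod_{1\le j_1<\cdots<j_m\le nm}\Bigl(1+t\prod_{k=1}^mX_{j_k}\Bigr)$$ (with $X=(X_1,\ldots,X_{nm})$). A $\lambda$-ring structure $\tau$ is special if $\tau^n(1)=0$ for $n\ge 2$, $\tau^n(xy)=P_n(\tau^1(x),\ldots,\tau^n(x),\tau^1(y),\ldots,\tau^n(y))$ and $\tau^n(\tau^m(x))=P_{n,m}(\tau^1(x),\ldots,\tau^{nm}(x))$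 for all $x,y\in R$ and $n,m\ge 1$. **Adams operations.** Let $N_n\in\mathbb{Z}[s_1,\ldots,s_n]$ be the polynomial with $\sum_{i=1}^mX_i^n=N_n(e_1(X_1,\ldots,X_m),\ldots,e_n(X_1,\ldots,X_m))$ for all $m$. The Adams operations of $\sigma$ are $\psi_n(x)=N_n(\sigma^1(x),\ldots,\sigma^n(x))$, $n\ge 1$. **The theory $\mathcal{T}$.** A model of $\mathcal{T}$ is a commutative unital ring $R$ with a $\lambda$-ring structure $\lambda$ whose opposite structure $\sigma$ is special, together with the Adams operations $\psi$ of $\sigma$. The function symbols of $\mathcal{L}_\lambda$ are interpreted accordingly. **Depth.** For a term $\varphi$ in variables $x_1,\ldots,x_n$, $\operatorname{depth}(\varphi)\in\mathbb{Z}_{\ge0}^n$ is defined recursively: $\operatorname{depth}(0)=\operatorname{depth}(1)=(0,\ldots,0)$; $\operatorname{depth}(x_i)$ is the $i$-th unit vector; $\operatorname{depth}(-\varphi)=\operatorname{depth}(\varphi)$; $\operatorname{depth}(\varphi+\xi)=\operatorname{depth}(\varphi\cdot\xi)$ is the componentwise maximum of $\operatorname{depth}(\varphi)$ and $\operatorname{depth}(\xi)$; $\operatorname{depth}(\lambda^k(\varphi))=\operatorname{depth}(\sigma^k(\varphi))=\operatorname{depth}(\psi_k(\varphi))=k\operatorname{depth}(\varphi)$ for $k\ge1$. *)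

theory Defs
  imports
    "HOL-Algebra.Ring"
    "HOL-Library.Poly_Mapping"
    "HOL-Computational_Algebra.Polynomial"
begin

section \<open>Integral polynomials in arbitrarily many variables\<close>

text \<open>
  A polynomial maps monomials (finitely supported exponent vectors) to integer coefficients;
  ring operations are the library's convolution operations on finitely supported maps.
\<close>

type_synonym 'v zpoly = "('v \<Rightarrow>\<^sub>0 nat) \<Rightarrow>\<^sub>0 int"

definition zvar :: "'v \<Rightarrow> 'v zpoly" where
  "zvar v = Poly_Mapping.single (Poly_Mapping.single v 1) 1"

definition zpolys_in :: "'v set \<Rightarrow> 'v zpoly set" where
  "zpolys_in V = {p. \<forall>m\<in>Poly_Mapping.keys p. Poly_Mapping.keys m \<subseteq> V}"

definition zsubst :: "('v \<Rightarrow> 'a) \<Rightarrow> 'v zpoly \<Rightarrow> 'a :: comm_ring_1" where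
  "zsubst f p = (\<Sum>m\<in>Poly_Mapping.keys p. of_int (Poly_Mapping.lookup p m) *
      (\<Prod>v\<in>Poly_Mapping.keys m. f v ^ Poly_Mapping.lookup m v))"

text \<open>The same evaluation, in a ring given by an explicit carrier.\<close>

definition zeval :: "('a, 'm) ring_scheme \<Rightarrow> ('v \<Rightarrow> 'a) \<Rightarrow> 'v zpoly \<Rightarrow> 'a" where
  "zeval R f p = (\<Oplus>\<^bsub>R\<^esub>m\<in>Poly_Mapping.keys p. [Poly_Mapping.lookup p m] \<cdot>\<^bsub>R\<^esub>
      (\<Otimes>\<^bsub>R\<^esub>v\<in>Poly_Mapping.keys m. f v [^]\<^bsub>R\<^esub> Poly_Mapping.lookup m v))"


section \<open>The universal polynomials\<close>

text \<open>\<open>esym x m k\<close> is \<open>e\<^sub>k(x\<^sub>1, \<dots>, x\<^sub>m)\<close>; in particular it is \<open>0\<close> for \<open>k > m\<close>.\<close>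

definition esym :: "(nat \<Rightarrow> 'a :: comm_ring_1) \<Rightarrow> nat \<Rightarrow> nat \<Rightarrow> 'a" where
  "esym x m k = (\<Sum>J | J \<subseteq> {1..m} \<and> card J = k. \<Prod>j\<in>J. x j)"

text \<open>
  In \<open>prod_poly n\<close> the variables \<open>Inl k\<close> and \<open>Inr k\<close> stand for the first and second
  group of arguments, and likewise \<open>Inl i\<close> for \<open>X\<^sub>i\<close> and \<open>Inr j\<close> for \<open>Y\<^sub>j\<close>. The products over
  \<open>1 + t \<cdot> _\<close> are univariate polynomials in \<open>t\<close> with coefficients in \<open>zpoly\<close>.
\<close>

definition prod_poly :: "nat \<Rightarrow> (nat + nat) zpoly" where
  "prod_poly n = (THE P. P \<in> zpolys_in ({1..n} <+> {1..n}) \<and>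
     zsubst (case_sum (esym (\<lambda>i. zvar (Inl i)) n) (esym (\<lambda>j. zvar (Inr j)) n)) P =
       coeff (\<Prod>i\<in>{1..n}. \<Prod>j\<in>{1..n}.
         [: 1, zvar (Inl i :: nat + nat) * zvar (Inr j) :]) n)"

definition comp_poly :: "nat \<Rightarrow> nat \<Rightarrow> nat zpoly" where
  "comp_poly n m = (THE P. P \<in> zpolys_in {1..n * m} \<and>
     zsubst (esym zvar (n * m)) P =
       coeff (\<Prod>J | J \<subseteq> {1..n * m} \<and> card J = m. [: 1, \<Prod>k\<in>J. zvar k :]) n)"

definition newton_poly :: "nat \<Rightarrow> nat zpoly" where
  "newton_poly n = (THE P. P \<in> zpolys_in {1..n} \<and>
     (\<forall>m. zsubst (esym zvar m) P = (\<Sum>i\<in>{1..m}. zvar i ^ n :: nat zpoly)))"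


section \<open>Lambda-rings\<close>

definition lambda_ring :: "('a, 'm) ring_scheme \<Rightarrow> (nat \<Rightarrow> 'a \<Rightarrow> 'a) \<Rightarrow> bool" where
  "lambda_ring R l \<longleftrightarrow> cring R \<and>
     (\<forall>i. l i \<in> carrier R \<rightarrow> carrier R) \<and>
     (\<forall>x\<in>carrier R. l 0 x = \<one>\<^bsub>R\<^esub>) \<and>
     (\<forall>x\<in>carrier R. l 1 x = x) \<and>
     (\<forall>n. \<forall>x\<in>carrier R. \<forall>y\<in>carrier R.
        l n (x \<oplus>\<^bsub>R\<^esub> y) = (\<Oplus>\<^bsub>R\<^esub>i\<in>{0..n}. l i x \<otimes>\<^bsub>R\<^esub> l (n - i) y))"

text \<open>The ring \<open>R[[t]]\<close>; a power series is its sequence of coefficients.\<close>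

definition power_series_ring :: "('a, 'm) ring_scheme \<Rightarrow> (nat \<Rightarrow> 'a) ring" where
  "power_series_ring R = \<lparr>
     carrier = {f. \<forall>n. f n \<in> carrier R},
     monoid.mult = (\<lambda>f g n. \<Oplus>\<^bsub>R\<^esub>i\<in>{0..n}. f i \<otimes>\<^bsub>R\<^esub> g (n - i)),
     one = (\<lambda>n. if n = 0 then \<one>\<^bsub>R\<^esub> else \<zero>\<^bsub>R\<^esub>),
     zero = (\<lambda>n. \<zero>\<^bsub>R\<^esub>),
     add = (\<lambda>f g n. f n \<oplus>\<^bsub>R\<^esub> g n)\<rparr>"

text \<open>\<open>\<sigma>\<^sub>t(x) = (\<lambda>\<^bsub>-t\<^esub>(x))\<^sup>-\<^sup>1\<close>, where \<open>\<lambda>\<^bsub>-t\<^esub>(x)\<close> has \<open>i\<close>-th coefficient \<open>(-1)\<^sup>i \<lambda>\<^sup>i(x)\<close>.\<close>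

definition opposite :: "('a, 'm) ring_scheme \<Rightarrow> (nat \<Rightarrow> 'a \<Rightarrow> 'a) \<Rightarrow> nat \<Rightarrow> 'a \<Rightarrow> 'a" where
  "opposite R l n x =
     (inv\<^bsub>power_series_ring R\<^esub> (\<lambda>i. ((\<ominus>\<^bsub>R\<^esub> \<one>\<^bsub>R\<^esub>) [^]\<^bsub>R\<^esub> i) \<otimes>\<^bsub>R\<^esub> l i x)) n"

definition special :: "('a, 'm) ring_scheme \<Rightarrow> (nat \<Rightarrow> 'a \<Rightarrow> 'a) \<Rightarrow> bool" where
  "special R \<tau> \<longleftrightarrow> lambda_ring R \<tau> \<and>
     (\<forall>n\<ge>2. \<tau> n \<one>\<^bsub>R\<^esub> = \<zero>\<^bsub>R\<^esub>) \<and>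
     (\<forall>n\<ge>1. \<forall>x\<in>carrier R. \<forall>y\<in>carrier R.
        \<tau> n (x \<otimes>\<^bsub>R\<^esub> y) = zeval R (case_sum (\<lambda>i. \<tau> i x) (\<lambda>i. \<tau> i y)) (prod_poly n)) \<and>
     (\<forall>n\<ge>1. \<forall>m\<ge>1. \<forall>x\<in>carrier R.
        \<tau> n (\<tau> m x) = zeval R (\<lambda>i. \<tau> i x) (comp_poly n m))"

definition adams :: "('a, 'm) ring_scheme \<Rightarrow> (nat \<Rightarrow> 'a \<Rightarrow> 'a) \<Rightarrow> nat \<Rightarrow> 'a \<Rightarrow> 'a" where
  "adams R \<tau> n x = zeval R (\<lambda>i. \<tau> i x) (newton_poly n)"

text \<open>Operations are constrained only on the carrier, and Adams operations only in degree \<open>\<ge> 1\<close>.\<close>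

definition model_of_T ::
  "('a, 'm) ring_scheme \<Rightarrow> (nat \<Rightarrow> 'a \<Rightarrow> 'a) \<Rightarrow> (nat \<Rightarrow> 'a \<Rightarrow> 'a) \<Rightarrow> (nat \<Rightarrow> 'a \<Rightarrow> 'a) \<Rightarrow> bool"
where
  "model_of_T R l s \<psi> \<longleftrightarrow> cring R \<and> lambda_ring R l \<and>
     (\<forall>n. \<forall>x\<in>carrier R. s n x = opposite R l n x) \<and>
     special R s \<and>
     (\<forall>n\<ge>1. \<forall>x\<in>carrier R. \<psi> n x = adams R s n x)"


section \<open>Terms\<close>

datatype lterm =
    Zero | One | Var nat | Neg lterm | Add lterm lterm | Mul lterm lterm
  | Lam nat lterm | Sig nat lterm | Psi nat lterm

text \<open>
  Terms of the language in the variables \<open>x\<^sub>1, \<dots>, x\<^sub>n\<close>: the operation symbols exist only for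
  \<open>k \<ge> 1\<close>, which the datatype does not enforce.
\<close>

fun term_in :: "nat \<Rightarrow> lterm \<Rightarrow> bool" where
  "term_in n Zero \<longleftrightarrow> True"
| "term_in n One \<longleftrightarrow> True"
| "term_in n (Var i) \<longleftrightarrow> 1 \<le> i \<and> i \<le> n"
| "term_in n (Neg a) \<longleftrightarrow> term_in n a"
| "term_in n (Add a b) \<longleftrightarrow> term_in n a \<and> term_in n b"
| "term_in n (Mul a b) \<longleftrightarrow> term_in n a \<and> term_in n b"
| "term_in n (Lam k a) \<longleftrightarrow> 1 \<le> k \<and> term_in n a"
| "term_in n (Sig k a) \<longleftrightarrow> 1 \<le> k \<and> term_in n a"
| "term_in n (Psi k a) \<longleftrightarrow> 1 \<le> k \<and> term_in n a"

text \<open>\<open>depth a i\<close> is the \<open>i\<close>-th component of the depth vector of \<open>a\<close>.\<close>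

fun depth :: "lterm \<Rightarrow> nat \<Rightarrow> nat" where
  "depth Zero i = 0"
| "depth One i = 0"
| "depth (Var j) i = (if i = j then 1 else 0)"
| "depth (Neg a) i = depth a i"
| "depth (Add a b) i = max (depth a i) (depth b i)"
| "depth (Mul a b) i = max (depth a i) (depth b i)"
| "depth (Lam k a) i = k * depth a i"
| "depth (Sig k a) i = k * depth a i"
| "depth (Psi k a) i = k * depth a i"

fun interp :: "('a, 'm) ring_scheme \<Rightarrow> (nat \<Rightarrow> 'a \<Rightarrow> 'a) \<Rightarrow> (nat \<Rightarrow> 'a \<Rightarrow> 'a) \<Rightarrow> (nat \<Rightarrow> 'a \<Rightarrow> 'a) \<Rightarrow>
    (nat \<Rightarrow> 'a) \<Rightarrow> lterm \<Rightarrow> 'a" where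
  "interp R l s \<psi> r Zero = \<zero>\<^bsub>R\<^esub>"
| "interp R l s \<psi> r One = \<one>\<^bsub>R\<^esub>"
| "interp R l s \<psi> r (Var i) = r i"
| "interp R l s \<psi> r (Neg a) = \<ominus>\<^bsub>R\<^esub> interp R l s \<psi> r a"
| "interp R l s \<psi> r (Add a b) = interp R l s \<psi> r a \<oplus>\<^bsub>R\<^esub> interp R l s \<psi> r b"
| "interp R l s \<psi> r (Mul a b) = interp R l s \<psi> r a \<otimes>\<^bsub>R\<^esub> interp R l s \<psi> r b"
| "interp R l s \<psi> r (Lam k a) = l k (interp R l s \<psi> r a)"
| "interp R l s \<psi> r (Sig k a) = s k (interp R l s \<psi> r a)"
| "interp R l s \<psi> r (Psi k a) = \<psi> k (interp R l s \<psi> r a)"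

text \<open>
  The polynomial ring of the theorem has a variable \<open>(i, j)\<close>, standing for \<open>x\<^bsub>i,j\<^esub>\<close>, for
  each \<open>1 \<le> i \<le> n\<close> and \<open>1 \<le> j \<le> d\<^sub>i\<close>.
\<close>

definition depth_polys :: "nat \<Rightarrow> (nat \<Rightarrow> nat) \<Rightarrow> (nat \<times> nat) zpoly set" where
  "depth_polys n d = zpolys_in (SIGMA i:{1..n}. {1..d i})"

text \<open>
  HOL cannot quantify over types inside a formula, so ``every model'' is relative to a type
  \<open>'a\<close> that contains the carrier; all rings carried by subsets of \<open>'a\<close> are covered.
  To make a representing polynomial independent of \<open>'a\<close>, require that it also represent \<open>\<phi>\<close>
  at the type \<open>nat\<close> and be the only polynomial that does so: the models over \<open>nat\<close> are, up to
  isomorphism, all countable models, and these already include the free ones.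
\<close>

definition lambda_represents ::
  "'a itself \<Rightarrow> nat \<Rightarrow> lterm \<Rightarrow> (nat \<times> nat) zpoly \<Rightarrow> bool" where
  "lambda_represents TA n \<phi> P \<longleftrightarrow>
     (\<forall>(R :: 'a ring) l s \<psi> r. model_of_T R l s \<psi> \<longrightarrow> (\<forall>i\<in>{1..n}. r i \<in> carrier R) \<longrightarrow>
        interp R l s \<psi> r \<phi> = zeval R (\<lambda>(i, j). l j (r i)) P)"

definition sigma_represents ::
  "'a itself \<Rightarrow> nat \<Rightarrow> lterm \<Rightarrow> (nat \<times> nat) zpoly \<Rightarrow> bool" where
  "sigma_represents TA n \<phi> P \<longleftrightarrow>
     (\<forall>(R :: 'a ring) l s \<psi> r. model_of_T R l s \<psi> \<longrightarrow> (\<forall>i\<in>{1..n}. r i \<in> carrier R) \<longrightarrow>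
        interp R l s \<psi> r \<phi> = zeval R (\<lambda>(i, j). s j (r i)) P)"

end

(*
  Existence: over any model, sigma^k of a term is computed from the sigma^j of its subterms by the
  universal polynomials (lambda^m is (-1)^m sigma^m(-x), and psi_m is itself a term in the sigma^j),
  so the sigma-polynomial is built by structural recursion. The lambda-polynomial follows by
  inverting the power series lambda_{-t}(x).

  Uniqueness: let the multiplicative monoid of positive integers act on points p : nat => nat => C
  by (k.p) i j = p i (k j), and on functions of points by psi_k f p = f (k.p). Newton's recursion
  turns these Adams operations into sigma-operations. Over C any power sums up to degree N come
  from N numbers X_i, so the specialness axioms hold pointwise by splitting, and the values of
  sigma^j(x_i) at a point can be prescribed freely, so no two polynomials represent the same term.
  The functions that are values of terms form a countable model, which is transported to nat.
*)

theory Submission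
  imports
    Defs
    "HOL-Library.Countable_Set"
    "HOL-Computational_Algebra.Formal_Power_Series"
    "HOL-Computational_Algebra.Fundamental_Theorem_Algebra"
begin

section \<open>Evaluation is a ring homomorphism\<close>

text \<open>The universal polynomials are definite descriptions, so nothing can be read off from
  them before unique existence is known. Integrality shapes that proof: expressing elementary
  symmetric functions through power sums needs division, so the product and composition polynomials
  are obtained from the fundamental theorem on symmetric polynomials over the integers, while power
  sums are expressed through elementary symmetric functions without division. Three properties of
  the complex numbers make them the test ring: they are infinite, so a nonzero polynomial has a
  nonzero value; they have characteristic 0, so Newton's recursion can be divided by
  \<open>n\<close>; they are algebraically closed, so prescribed elementary symmetric functions are
  attained. The model is described by Adams operations because these are ring endomorphisms: in
  terms of power sums, addition and multiplication are componentwise and composition multiplies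
  indices. All functions of points would be too many for a carrier in \<open>nat\<close>, hence the
  restriction to values of terms.\<close>

lemma poly_mapping_sum_single:
  "p = (\<Sum>m\<in>Poly_Mapping.keys p. Poly_Mapping.single m (Poly_Mapping.lookup p m))"
  by (rule poly_mapping_eqI)
    (simp add: lookup_sum lookup_single when_def not_in_keys_iff_lookup_eq_zero)

lemma zpoly_single_induct:
  assumes "P 0" and "\<And>m c p. P p \<Longrightarrow> P (Poly_Mapping.single m c + p)"
  shows "P (p :: 'a \<Rightarrow>\<^sub>0 'b :: comm_monoid_add)"
proof -
  have *: "P (\<Sum>m\<in>A. Poly_Mapping.single m (Poly_Mapping.lookup p m))" if "finite A" for A
    using that by (induction A rule: finite_induct) (auto intro: assms)
  show ?thesis
    by (subst poly_mapping_sum_single) (rule *, simp)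
qed

definition zmon :: "('a, 'm) ring_scheme \<Rightarrow> ('v \<Rightarrow> 'a) \<Rightarrow> ('v \<Rightarrow>\<^sub>0 nat) \<Rightarrow> 'a" where
  "zmon R f m = (\<Otimes>\<^bsub>R\<^esub>v\<in>Poly_Mapping.keys m. f v [^]\<^bsub>R\<^esub> Poly_Mapping.lookup m v)"

context cring
begin

lemma zmon_closed [simp]: "(\<And>v. f v \<in> carrier R) \<Longrightarrow> zmon R f m \<in> carrier R"
  unfolding zmon_def by (rule finprod_closed) auto

lemma zmon_superset:
  assumes "\<And>v. f v \<in> carrier R" "finite A" "Poly_Mapping.keys m \<subseteq> A"
  shows "zmon R f m = (\<Otimes>v\<in>A. f v [^] Poly_Mapping.lookup m v)"
  unfolding zmon_def
  by (rule finprod_mono_neutral_cong_left)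
    (use assms in \<open>auto simp: not_in_keys_iff_lookup_eq_zero\<close>)

lemma zmon_add:
  assumes f: "\<And>v. f v \<in> carrier R"
  shows "zmon R f (m + m') = zmon R f m \<otimes> zmon R f m'"
proof -
  let ?A = "Poly_Mapping.keys m \<union> Poly_Mapping.keys m'"
  have "zmon R f (m + m') = (\<Otimes>v\<in>?A. f v [^] Poly_Mapping.lookup (m + m') v)"
    by (rule zmon_superset) (use assms keys_add[of m m'] in auto)
  also have "\<dots> = (\<Otimes>v\<in>?A. f v [^] Poly_Mapping.lookup m v \<otimes> f v [^] Poly_Mapping.lookup m' v)"
    by (rule finprod_cong') (use f in \<open>auto simp: lookup_add nat_pow_mult\<close>)
  also have "\<dots> = (\<Otimes>v\<in>?A. f v [^] Poly_Mapping.lookup m v) \<otimes> (\<Otimes>v\<in>?A. f v [^] Poly_Mapping.lookup m' v)"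
    by (rule finprod_multf) (use f in auto)
  also have "\<dots> = zmon R f m \<otimes> zmon R f m'"
    by (simp add: zmon_superset[of f ?A] f)
  finally show ?thesis .
qed

lemma zmon_zero [simp]: "zmon R f 0 = \<one>"
  by (simp add: zmon_def)

lemma zeval_zmon: "zeval R f p = (\<Oplus>m\<in>Poly_Mapping.keys p. [Poly_Mapping.lookup p m] \<cdot> zmon R f m)"
  by (simp add: zeval_def zmon_def)

lemma add_pow_0_int [simp]: "[(0 :: int)] \<cdot> x = \<zero>"
  by (simp add: add_pow_def)

text \<open>Cancellation can shrink the support of a sum, so additivity is proved over a common
  finite index set; monomials outside the support have coefficient 0 there.\<close>

lemma zeval_superset:
  assumes "\<And>v. f v \<in> carrier R" "finite A" "Poly_Mapping.keys p \<subseteq> A"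
  shows "zeval R f p = (\<Oplus>m\<in>A. [Poly_Mapping.lookup p m] \<cdot> zmon R f m)"
  unfolding zeval_zmon
  by (rule add.finprod_mono_neutral_cong_left)
    (use assms in \<open>auto simp: not_in_keys_iff_lookup_eq_zero\<close>)

lemma zeval_closed [simp]: "(\<And>v. f v \<in> carrier R) \<Longrightarrow> zeval R f p \<in> carrier R"
  unfolding zeval_zmon by (rule finsum_closed) auto

lemma zeval_add:
  assumes f: "\<And>v. f v \<in> carrier R"
  shows "zeval R f (p + q) = zeval R f p \<oplus> zeval R f q"
proof -
  let ?A = "Poly_Mapping.keys p \<union> Poly_Mapping.keys q"
  have "zeval R f (p + q) = (\<Oplus>m\<in>?A. [Poly_Mapping.lookup (p + q) m] \<cdot> zmon R f m)"
    by (rule zeval_superset) (use assms keys_add[of p q] in auto)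
  also have "\<dots> = (\<Oplus>m\<in>?A. [Poly_Mapping.lookup p m] \<cdot> zmon R f m \<oplus> [Poly_Mapping.lookup q m] \<cdot> zmon R f m)"
    by (rule finsum_cong') (use f in \<open>auto simp: lookup_add add.int_pow_mult\<close>)
  also have "\<dots> = (\<Oplus>m\<in>?A. [Poly_Mapping.lookup p m] \<cdot> zmon R f m) \<oplus> (\<Oplus>m\<in>?A. [Poly_Mapping.lookup q m] \<cdot> zmon R f m)"
    by (rule finsum_addf) (use f in auto)
  also have "\<dots> = zeval R f p \<oplus> zeval R f q"
    by (simp add: zeval_superset[of f ?A] f)
  finally show ?thesis .
qed

lemma zeval_single:
  assumes f: "\<And>v. f v \<in> carrier R"
  shows "zeval R f (Poly_Mapping.single m c) = [c] \<cdot> zmon R f m"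
  by (subst zeval_superset[of f "{m}"]) (use f in auto)

lemma zeval_0 [simp]: "zeval R f 0 = \<zero>"
  by (simp add: zeval_def)

lemma zeval_1 [simp]: "(\<And>v. f v \<in> carrier R) \<Longrightarrow> zeval R f 1 = \<one>"
  using zeval_single[of f 0 1] by (simp del: single_one add: single_one[symmetric])

lemma zeval_zvar [simp]: "(\<And>v. f v \<in> carrier R) \<Longrightarrow> zeval R f (zvar v) = f v"
  unfolding zvar_def by (subst zeval_single) (auto simp: zmon_superset[of f "{v}"])

lemma zeval_mult:
  fixes p q :: "'v zpoly"
  assumes f: "\<And>v. f v \<in> carrier R"
  shows "zeval R f (p * q) = zeval R f p \<otimes> zeval R f q"
proof (induction p rule: zpoly_single_induct [case_names 1 2])
  case (2 m c p)
  have "zeval R f (Poly_Mapping.single m c * q) = zeval R f (Poly_Mapping.single m c) \<otimes> zeval R f q"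
  proof (induction q rule: zpoly_single_induct [case_names 1 2])
    case (2 m' c' q)
    have "[(c * c')] \<cdot> zmon R f (m + m') = [c] \<cdot> zmon R f m \<otimes> [c'] \<cdot> zmon R f m'"
      using f by (simp add: zmon_add add_pow_ldistr_int add_pow_rdistr_int add.int_pow_pow mult.commute)
    with 2 show ?case
      using f by (simp add: distrib_left zeval_add zeval_single mult_single r_distr)
  qed (use f in simp)
  with 2 show ?case
    using f by (simp add: distrib_right zeval_add l_distr)
qed (use f in simp)

lemma zeval_uminus:
  assumes f: "\<And>v. f v \<in> carrier R"
  shows "zeval R f (- p) = \<ominus> zeval R f p"
proof -
  have "zeval R f (- p) \<oplus> zeval R f p = \<zero>"
    using zeval_add[of f "- p" p] f by simp
  then show ?thesis
    using f by (simp add: minus_equality)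
qed

lemma zeval_sum:
  assumes f: "\<And>v. f v \<in> carrier R" and "finite A"
  shows "zeval R f (\<Sum>i\<in>A. g i) = (\<Oplus>i\<in>A. zeval R f (g i))"
  using assms(2) by (induction A rule: finite_induct) (use f in \<open>auto simp: zeval_add\<close>)

end

subsection \<open>Polynomials in a given set of variables\<close>

lemma zpolys_in_mono: "V \<subseteq> W \<Longrightarrow> zpolys_in V \<subseteq> zpolys_in W"
  by (auto simp: zpolys_in_def)

lemma zpolys_in_UNIV [simp]: "zpolys_in UNIV = UNIV"
  by (auto simp: zpolys_in_def)

lemma zpolys_in_0 [simp]: "0 \<in> zpolys_in V"
  and zpolys_in_1 [simp]: "1 \<in> zpolys_in V"
  and zpolys_in_zvar: "v \<in> V \<Longrightarrow> zvar v \<in> zpolys_in V"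
  by (auto simp: zpolys_in_def zvar_def)

lemma zpolys_in_add: "p \<in> zpolys_in V \<Longrightarrow> q \<in> zpolys_in V \<Longrightarrow> p + q \<in> zpolys_in V"
  using keys_add[of p q] by (auto simp: zpolys_in_def)

lemma zpolys_in_uminus: "p \<in> zpolys_in V \<Longrightarrow> - p \<in> zpolys_in V"
  by (auto simp: zpolys_in_def)

lemma zpolys_in_mult: "p \<in> zpolys_in V \<Longrightarrow> q \<in> zpolys_in V \<Longrightarrow> p * q \<in> zpolys_in V"
proof -
  assume p: "p \<in> zpolys_in V" and q: "q \<in> zpolys_in V"
  have "Poly_Mapping.keys (a + b) \<subseteq> V" 
    if "a \<in> Poly_Mapping.keys p" "b \<in> Poly_Mapping.keys q" for a b
    using that p q keys_add[of a b] by (fastforce simp: zpolys_in_def)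
  then show ?thesis
    using keys_mult[of p q] by (fastforce simp: zpolys_in_def)
qed

lemma zpolys_in_sum: "(\<And>i. i \<in> A \<Longrightarrow> g i \<in> zpolys_in V) \<Longrightarrow> sum g A \<in> zpolys_in V"
  by (induction A rule: infinite_finite_induct) (auto intro: zpolys_in_add)

lemma zpolys_in_power: "p \<in> zpolys_in V \<Longrightarrow> p ^ k \<in> zpolys_in V"
  by (induction k) (auto intro: zpolys_in_mult)

lemma zpolys_in_diff: "p \<in> zpolys_in V \<Longrightarrow> q \<in> zpolys_in V \<Longrightarrow> p - q \<in> zpolys_in V"
  using zpolys_in_add[OF _ zpolys_in_uminus, of p V q] by simp

lemma zpolys_in_of_int [simp]: "of_int c \<in> zpolys_in V"
  by (auto simp: zpolys_in_def simp flip: single_of_int split: if_splits)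

text \<open>The subring generated by \<open>G\<close>. Being an integral polynomial in certain
  elements becomes a closure statement, so that no explicit polynomial has to be carried through the
  symmetric function argument.\<close>

inductive_set ring_hull :: "'a :: comm_ring_1 set \<Rightarrow> 'a set" for G where
  base: "g \<in> G \<Longrightarrow> g \<in> ring_hull G"
| one: "1 \<in> ring_hull G"
| uminus: "p \<in> ring_hull G \<Longrightarrow> - p \<in> ring_hull G"
| add: "p \<in> ring_hull G \<Longrightarrow> q \<in> ring_hull G \<Longrightarrow> p + q \<in> ring_hull G"
| mult: "p \<in> ring_hull G \<Longrightarrow> q \<in> ring_hull G \<Longrightarrow> p * q \<in> ring_hull G"

lemma ring_hull_0: "0 \<in> ring_hull G"
  using ring_hull.add[OF ring_hull.one ring_hull.uminus[OF ring_hull.one], of G] by simp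

lemma ring_hull_diff: "p \<in> ring_hull G \<Longrightarrow> q \<in> ring_hull G \<Longrightarrow> p - q \<in> ring_hull G"
  using ring_hull.add[OF _ ring_hull.uminus, of p G q] by simp

lemma ring_hull_sum: "(\<And>i. i \<in> A \<Longrightarrow> g i \<in> ring_hull G) \<Longrightarrow> sum g A \<in> ring_hull G"
  by (induction A rule: infinite_finite_induct) (auto intro: ring_hull.add ring_hull_0)

lemma ring_hull_prod: "(\<And>i. i \<in> A \<Longrightarrow> g i \<in> ring_hull G) \<Longrightarrow> prod g A \<in> ring_hull G"
  by (induction A rule: infinite_finite_induct) (auto intro: ring_hull.mult ring_hull.one)

lemma ring_hull_power: "p \<in> ring_hull G \<Longrightarrow> p ^ k \<in> ring_hull G"
  by (induction k) (auto intro: ring_hull.one ring_hull.mult)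

lemma ring_hull_of_int: "of_int c \<in> ring_hull G"
proof (induction c rule: int_induct[where k = 0])
  case base
  then show ?case by (simp add: ring_hull_0)
next
  case (step1 i)
  then show ?case by (simp add: ring_hull.add ring_hull.one)
next
  case (step2 i)
  then show ?case by (simp add: ring_hull_diff ring_hull.one)
qed

lemma ring_hull_least:
  assumes "G \<subseteq> ring_hull H"
  shows "ring_hull G \<subseteq> ring_hull H"
proof
  fix p assume "p \<in> ring_hull G"
  then show "p \<in> ring_hull H"
    by induction (use assms in \<open>auto intro: ring_hull.intros\<close>)
qed

lemma single_eq_monomial:
  assumes "finite A" "Poly_Mapping.keys m \<subseteq> A"
  shows "Poly_Mapping.single m (c :: int) = of_int c * (\<Prod>v\<in>A. zvar v ^ Poly_Mapping.lookup m v)"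
proof -
  have power: "zvar v ^ k = Poly_Mapping.single (Poly_Mapping.single v k) 1" for v :: 'a and k
    by (induction k) (auto simp: zvar_def mult_single single_add[symmetric])
  have "(\<Prod>v\<in>A. zvar v ^ Poly_Mapping.lookup m v) =
      Poly_Mapping.single (\<Sum>v\<in>A. Poly_Mapping.single v (Poly_Mapping.lookup m v)) 1"
    using assms(1) by (induction A rule: finite_induct) (auto simp: power mult_single)
  also have "(\<Sum>v\<in>A. Poly_Mapping.single v (Poly_Mapping.lookup m v)) = m"
    using assms by (intro poly_mapping_eqI)
      (auto simp: lookup_sum lookup_single when_def not_in_keys_iff_lookup_eq_zero)
  finally show ?thesis
    by (simp add: mult_single flip: single_of_int)
qed

text \<open>Turns the support condition into a closure condition; the induction rule over variables,
  1 and the ring operations results from it.\<close>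

lemma zpolys_in_eq_ring_hull: "zpolys_in V = ring_hull (zvar ` V)"
proof
  show "ring_hull (zvar ` V) \<subseteq> zpolys_in V"
  proof
    fix p assume "p \<in> ring_hull (zvar ` V)"
    then show "p \<in> zpolys_in V"
      by induction (auto intro: zpolys_in_zvar zpolys_in_add zpolys_in_mult zpolys_in_uminus)
  qed
  show "zpolys_in V \<subseteq> ring_hull (zvar ` V)"
  proof
    fix p :: "'a zpoly" assume p: "p \<in> zpolys_in V"
    have "p = (\<Sum>m\<in>Poly_Mapping.keys p. Poly_Mapping.single m (Poly_Mapping.lookup p m))"
      by (rule poly_mapping_sum_single)
    also have "\<dots> \<in> ring_hull (zvar ` V)"
    proof (rule ring_hull_sum)
      fix m assume "m \<in> Poly_Mapping.keys p"
      with p have m: "Poly_Mapping.keys m \<subseteq> V"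
        by (auto simp: zpolys_in_def)
      have "of_int c * (\<Prod>v\<in>Poly_Mapping.keys m. zvar v ^ Poly_Mapping.lookup m v) \<in> ring_hull (zvar ` V)" for c
        by (intro ring_hull.mult ring_hull_of_int ring_hull_prod ring_hull_power ring_hull.base)
          (use m in auto)
      then show "Poly_Mapping.single m (Poly_Mapping.lookup p m) \<in> ring_hull (zvar ` V)"
        by (subst single_eq_monomial[of "Poly_Mapping.keys m"]) auto
    qed
    finally show "p \<in> ring_hull (zvar ` V)" .
  qed
qed

lemma zpolys_in_induct [consumes 1, case_names zvar one uminus add mult]:
  assumes "p \<in> zpolys_in V"
    and "\<And>v. v \<in> V \<Longrightarrow> P (zvar v)" and "P 1" and "\<And>p. p \<in> zpolys_in V \<Longrightarrow> P p \<Longrightarrow> P (- p)"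
    and "\<And>p q. p \<in> zpolys_in V \<Longrightarrow> q \<in> zpolys_in V \<Longrightarrow> P p \<Longrightarrow> P q \<Longrightarrow> P (p + q)"
    and "\<And>p q. p \<in> zpolys_in V \<Longrightarrow> q \<in> zpolys_in V \<Longrightarrow> P p \<Longrightarrow> P q \<Longrightarrow> P (p * q)"
  shows "P p"
  using assms(1) unfolding zpolys_in_eq_ring_hull
  by induction (use assms(2-) in \<open>auto simp: zpolys_in_eq_ring_hull\<close>)

lemma zpoly_induct [case_names zvar one uminus add mult]:
  assumes "\<And>v. P (zvar v)" and "P 1" and "\<And>p. P p \<Longrightarrow> P (- p)"
    and "\<And>p q. P p \<Longrightarrow> P q \<Longrightarrow> P (p + q)" and "\<And>p q. P p \<Longrightarrow> P q \<Longrightarrow> P (p * q)"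
  shows "P (p :: 'v zpoly)"
  using zpolys_in_induct[of p UNIV P] assms by auto

text \<open>The homomorphism laws want a value in the carrier for every variable. As
  \<open>f\<close> and \<open>g\<close> are arbitrary outside \<open>V\<close>, an assignment can
  first be completed by a default value.\<close>

lemma (in cring) zeval_cong:
  assumes p: "p \<in> zpolys_in V" and f: "\<And>v. v \<in> V \<Longrightarrow> f v \<in> carrier R"
    and fg: "\<And>v. v \<in> V \<Longrightarrow> g v = f v"
  shows "zeval R g p = zeval R f p"
  unfolding zeval_def
proof (rule finsum_cong'[OF refl])
  fix m assume "m \<in> Poly_Mapping.keys p"
  with p have m: "Poly_Mapping.keys m \<subseteq> V"
    by (auto simp: zpolys_in_def)
  have "(\<Otimes>v\<in>Poly_Mapping.keys m. g v [^] Poly_Mapping.lookup m v) =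
      (\<Otimes>v\<in>Poly_Mapping.keys m. f v [^] Poly_Mapping.lookup m v)"
    by (rule finprod_cong'[OF refl]) (use m f fg in auto)
  then show "[Poly_Mapping.lookup p m] \<cdot> (\<Otimes>v\<in>Poly_Mapping.keys m. g v [^] Poly_Mapping.lookup m v) =
      [Poly_Mapping.lookup p m] \<cdot> (\<Otimes>v\<in>Poly_Mapping.keys m. f v [^] Poly_Mapping.lookup m v)"
    by simp
next
  have "(\<Otimes>v\<in>Poly_Mapping.keys m. f v [^] Poly_Mapping.lookup m v) \<in> carrier R"
    if "m \<in> Poly_Mapping.keys p" for m
    by (rule finprod_closed) (use p f that in \<open>auto simp: zpolys_in_def\<close>)
  then show "(\<lambda>m. [Poly_Mapping.lookup p m] \<cdot> (\<Otimes>v\<in>Poly_Mapping.keys m. f v [^] Poly_Mapping.lookup m v))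
      \<in> Poly_Mapping.keys p \<rightarrow> carrier R"
    by auto
qed

subsection \<open>Evaluation in a ring type\<close>

text \<open>Makes \<open>zsubst\<close> an instance of \<open>zeval\<close>, so that the laws of
  evaluation are proved only once.\<close>

definition type_ring :: "'a :: comm_ring_1 ring" where
  "type_ring = \<lparr>carrier = UNIV, monoid.mult = (*), one = 1, zero = 0, add = (+)\<rparr>"

lemma type_ring_sel [simp]:
  "carrier type_ring = UNIV" "monoid.mult type_ring = (*)" "one type_ring = 1"
  "zero type_ring = 0" "add type_ring = (+)"
  by (simp_all add: type_ring_def)

lemma cring_type_ring: "cring (type_ring :: 'a :: comm_ring_1 ring)"
  by (rule cringI, rule abelian_groupI, auto simp: algebra_simps intro: comm_monoidI)
    (metis add.commute add.right_inverse)

interpretation type_ring: cring "type_ring :: 'a :: comm_ring_1 ring"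
  by (rule cring_type_ring)

lemma type_ring_pow: "x [^]\<^bsub>type_ring\<^esub> (k :: nat) = x ^ k"
  by (induction k) (auto simp: mult.commute)

lemma type_ring_finsum: "finsum type_ring f A = sum f A"
  by (induction A rule: infinite_finite_induct) auto

lemma type_ring_finprod: "finprod type_ring f A = prod f A"
  by (induction A rule: infinite_finite_induct) auto

lemma type_ring_a_inv: "\<ominus>\<^bsub>type_ring\<^esub> x = - x"
  by (rule type_ring.minus_equality) auto

lemma type_ring_int_mult: "[c] \<cdot>\<^bsub>type_ring\<^esub> x = of_int c * x"
proof (induction c rule: int_induct[where k = 0])
  case (step1 i)
  then show ?case by (simp add: type_ring.add.int_pow_mult algebra_simps)
next
  case (step2 i)
  then show ?case by (simp add: type_ring.add.int_pow_diff type_ring_a_inv algebra_simps)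
qed simp

lemma zsubst_eq_zeval: "zsubst f p = zeval type_ring f p"
  by (simp add: zsubst_def zeval_def type_ring_finsum type_ring_finprod type_ring_pow type_ring_int_mult)

lemma zsubst_add [simp]: "zsubst f (p + q) = zsubst f p + zsubst f q"
  and zsubst_mult [simp]: "zsubst f (p * q) = zsubst f p * zsubst f q"
  and zsubst_uminus [simp]: "zsubst f (- p) = - zsubst f p"
  and zsubst_0 [simp]: "zsubst f 0 = 0"
  and zsubst_1 [simp]: "zsubst f 1 = 1"
  and zsubst_zvar [simp]: "zsubst f (zvar v) = f v"
  by (simp_all add: zsubst_eq_zeval type_ring.zeval_add type_ring.zeval_mult type_ring.zeval_uminus
      type_ring_a_inv)

lemma zsubst_diff [simp]: "zsubst f (p - q) = zsubst f p - zsubst f q"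
  using zsubst_add[of f p "- q"] by simp

lemma zsubst_sum [simp]: "zsubst f (sum g A) = (\<Sum>i\<in>A. zsubst f (g i))"
  by (induction A rule: infinite_finite_induct) auto

lemma zsubst_prod [simp]: "zsubst f (prod g A) = (\<Prod>i\<in>A. zsubst f (g i))"
  by (induction A rule: infinite_finite_induct) auto

lemma zsubst_power [simp]: "zsubst f (p ^ k) = zsubst f p ^ k"
  by (induction k) auto

lemma zsubst_of_nat [simp]: "zsubst f (of_nat k) = of_nat k"
  by (induction k) auto

lemma zsubst_cong:
  assumes "p \<in> zpolys_in V" "\<And>v. v \<in> V \<Longrightarrow> f v = g v"
  shows "zsubst f p = zsubst g p"
  using assms(1) by (induction rule: zpolys_in_induct) (auto simp: assms(2))

lemma zsubst_zsubst: "zsubst f (zsubst g p) = zsubst (\<lambda>v. zsubst f (g v)) p"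
  by (induction p rule: zpoly_induct) auto

lemma zsubst_in_ring_hull:
  assumes "p \<in> zpolys_in V" "\<And>v. v \<in> V \<Longrightarrow> f v \<in> ring_hull G"
  shows "zsubst f p \<in> ring_hull G"
  using assms(1) by (induction rule: zpolys_in_induct) (auto intro: ring_hull.intros assms(2))

lemma zsubst_in_zpolys_in:
  assumes "p \<in> zpolys_in V" "\<And>v. v \<in> V \<Longrightarrow> f v \<in> zpolys_in W"
  shows "zsubst f p \<in> zpolys_in W"
  using zsubst_in_ring_hull[of p V f] assms unfolding zpolys_in_eq_ring_hull by blast

text \<open>The way back from subrings to polynomials: membership yields an explicit polynomial in
  the permitted variables. The universal polynomials are extracted here.\<close>

lemma ring_hull_image: "ring_hull (f ` V) = zsubst f ` zpolys_in V"
proof (intro equalityI subsetI)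
  fix p assume "p \<in> zsubst f ` zpolys_in V"
  then obtain q where q: "q \<in> zpolys_in V" "p = zsubst f q"
    by auto
  have "f v \<in> ring_hull (f ` V)" if "v \<in> V" for v
    using that by (simp add: ring_hull.base)
  with q show "p \<in> ring_hull (f ` V)"
    using zsubst_in_ring_hull by blast
next
  fix p assume "p \<in> ring_hull (f ` V)"
  then show "p \<in> zsubst f ` zpolys_in V"
  proof induction
    case (base g)
    then obtain v where "v \<in> V" "g = zsubst f (zvar v)" by auto
    then show ?case by (blast intro: zpolys_in_zvar)
  next
    case one
    then show ?case by (rule image_eqI[where x = 1]) simp_all
  next
    case (uminus p)
    then show ?case by (auto simp flip: zsubst_uminus intro!: imageI zpolys_in_uminus)
  next
    case (add p q)
    then show ?case by (auto simp flip: zsubst_add intro!: imageI zpolys_in_add)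
  next
    case (mult p q)
    then show ?case by (auto simp flip: zsubst_mult intro!: imageI zpolys_in_mult)
  qed
qed

lemma zsubst_ring_hull:
  assumes "p \<in> ring_hull G" "\<And>g. g \<in> G \<Longrightarrow> zsubst f g \<in> ring_hull H"
  shows "zsubst f p \<in> ring_hull H"
  using assms(1) by induction (auto intro: ring_hull.intros assms(2))

lemma (in cring) zeval_zsubst:
  assumes "\<And>v. f v \<in> carrier R"
  shows "zeval R f (zsubst g p) = zeval R (\<lambda>v. zeval R f (g v)) p"
  by (induction p rule: zpoly_induct) (simp_all add: assms zeval_add zeval_mult zeval_uminus)

section \<open>Elementary symmetric functions\<close>

text \<open>Arbitrary index sets are allowed because the product and composition polynomials are
  elementary symmetric functions of families indexed by pairs and by subsets.\<close>

definition elsym :: "('i \<Rightarrow> 'a :: comm_ring_1) \<Rightarrow> 'i set \<Rightarrow> nat \<Rightarrow> 'a" where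
  "elsym x I k = (\<Sum>J | J \<subseteq> I \<and> card J = k. \<Prod>j\<in>J. x j)"

lemma esym_eq_elsym: "esym x m k = elsym x {1..m} k"
  by (simp add: esym_def elsym_def)

lemma elsym_0 [simp]: "finite I \<Longrightarrow> elsym x I 0 = 1"
proof -
  assume "finite I"
  then have "{J. J \<subseteq> I \<and> card J = 0} = {{}}"
    by (auto dest: finite_subset)
  then show ?thesis by (simp add: elsym_def)
qed

lemma elsym_eq_0: "finite I \<Longrightarrow> card I < k \<Longrightarrow> elsym x I k = 0"
proof -
  assume "finite I" "card I < k"
  then have "{J. J \<subseteq> I \<and> card J = k} = {}"
    by (auto dest: card_mono)
  then show ?thesis by (simp add: elsym_def del: Collect_empty_eq)
qed

lemma elsym_insert:
  assumes "finite I" "a \<notin> I"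
  shows "elsym x (insert a I) (Suc k) = elsym x I (Suc k) + x a * elsym x I k"
proof -
  let ?A = "{J. J \<subseteq> I \<and> card J = Suc k}" and ?B = "{J. J \<subseteq> I \<and> card J = k}"
  have fin: "finite ?A" "finite ?B" using assms(1) by auto
  have finJ: "finite J" if "J \<subseteq> insert a I" for J
    using that assms(1) finite_subset by blast
  have eq: "{J. J \<subseteq> insert a I \<and> card J = Suc k} = ?A \<union> insert a ` ?B"
  proof (intro equalityI subsetI)
    fix J assume J: "J \<in> {J. J \<subseteq> insert a I \<and> card J = Suc k}"
    show "J \<in> ?A \<union> insert a ` ?B"
    proof (cases "a \<in> J")
      case True
      then have "J = insert a (J - {a})" by auto
      moreover have "J - {a} \<in> ?B"
        using J True finJ[of J] by auto
      ultimately show ?thesis by blast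
    next
      case False
      then show ?thesis using J by auto
    qed
  next
    fix J assume "J \<in> ?A \<union> insert a ` ?B"
    then show "J \<in> {J. J \<subseteq> insert a I \<and> card J = Suc k}"
      using assms finite_subset[of _ I] by (auto simp: card_insert_if)
  qed
  have inj: "inj_on (insert a) ?B"
    using assms(2) by (auto simp: inj_on_def)
  have "elsym x (insert a I) (Suc k) = (\<Sum>J\<in>?A. prod x J) + (\<Sum>J\<in>insert a ` ?B. prod x J)"
    unfolding elsym_def eq by (rule sum.union_disjoint) (use fin assms in auto)
  also have "(\<Sum>J\<in>insert a ` ?B. prod x J) = (\<Sum>J\<in>?B. x a * prod x J)"
    unfolding sum.reindex[OF inj] o_def
  proof (rule sum.cong)
    fix J assume "J \<in> ?B"
    then show "prod x (insert a J) = x a * prod x J"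
      using assms finJ[of J] by (subst prod.insert) auto
  qed simp
  finally show ?thesis by (simp add: elsym_def sum_distrib_left)
qed

lemma coeff_prod_linear:
  "finite I \<Longrightarrow> coeff (\<Prod>i\<in>I. [:1, x i:]) k = elsym x I k"
proof (induction I arbitrary: k rule: finite_induct)
  case empty
  show ?case by (cases k) (auto simp: elsym_eq_0)
next
  case (insert a I)
  then show ?case by (cases k) (auto simp: elsym_insert)
qed

text \<open>Both sides are coefficients of the same product of linear factors, so reindexing that
  product replaces a bijection between families of subsets.\<close>

lemma elsym_image:
  assumes "finite I" "inj_on h I"
  shows "elsym x (h ` I) k = elsym (\<lambda>i. x (h i)) I k"
  using assms coeff_prod_linear[of I "\<lambda>i. x (h i)" k] coeff_prod_linear[of "h ` I" x k]
  by (simp add: prod.reindex o_def)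

lemma elsym_cong: "(\<And>i. i \<in> I \<Longrightarrow> x i = y i) \<Longrightarrow> elsym x I k = elsym y I k"
  unfolding elsym_def by (intro sum.cong prod.cong) auto

lemma zsubst_elsym [simp]: "zsubst f (elsym x I k) = elsym (\<lambda>i. zsubst f (x i)) I k"
  by (simp add: elsym_def)

lemma elsym_in_ring_hull: "(\<And>i. i \<in> I \<Longrightarrow> x i \<in> ring_hull G) \<Longrightarrow> elsym x I k \<in> ring_hull G"
  unfolding elsym_def by (intro ring_hull_sum ring_hull_prod) auto

lemma prod_add_eq_elsym:
  "finite I \<Longrightarrow> (\<Prod>i\<in>I. y + x i) = (\<Sum>k\<le>card I. y ^ (card I - k) * elsym x I k)"
proof (induction I rule: finite_induct)
  case (insert a I)
  let ?n = "card I"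
  have "(\<Sum>k\<le>Suc ?n. y ^ (Suc ?n - k) * elsym x (insert a I) k) =
      y ^ Suc ?n + (\<Sum>k\<le>?n. y ^ (?n - k) * (elsym x I (Suc k) + x a * elsym x I k))"
    using insert by (subst sum.atMost_Suc_shift) (simp add: elsym_insert)
  also have "\<dots> = (y ^ Suc ?n + (\<Sum>k\<le>?n. y ^ (?n - k) * elsym x I (Suc k))) +
      x a * (\<Sum>k\<le>?n. y ^ (?n - k) * elsym x I k)"
    by (simp add: algebra_simps sum.distrib sum_distrib_left)
  also have "y ^ Suc ?n + (\<Sum>k\<le>?n. y ^ (?n - k) * elsym x I (Suc k)) =
      (\<Sum>k\<le>Suc ?n. y ^ (Suc ?n - k) * elsym x I k)"
    using insert by (subst sum.atMost_Suc_shift) simp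
  also have "\<dots> = (\<Sum>k\<le>?n. y ^ (Suc ?n - k) * elsym x I k)"
    using insert by (simp add: elsym_eq_0)
  also have "\<dots> = y * (\<Sum>k\<le>?n. y ^ (?n - k) * elsym x I k)"
    unfolding sum_distrib_left by (rule sum.cong) (auto simp: Suc_diff_le mult.assoc)
  finally show ?case
    using insert by (simp add: algebra_simps)
qed simp

text \<open>Newton's identity, adding one variable \<open>x a\<close> at a time. The products of old
  power sums recombine into the induction hypothesis at \<open>n\<close> and, multiplied by
  \<open>x a\<close>, at \<open>n - 1\<close>; the terms with powers of \<open>x a\<close> alone
  telescope to \<open>x a * elsym x I n\<close>. No division occurs, so any commutative ring is
  allowed.\<close>

lemma newton_identity:
  assumes "finite I"
  shows "of_nat (Suc n) * elsym x I (Suc n) =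
    (\<Sum>i\<le>n. (-1) ^ i * elsym x I (n - i) * (\<Sum>j\<in>I. x j ^ Suc i))"
  using assms
proof (induction I arbitrary: n rule: finite_induct)
  case empty
  then show ?case by (simp add: elsym_eq_0)
next
  case (insert a I)
  let ?e = "elsym x I" and ?p = "\<lambda>k. \<Sum>j\<in>I. x j ^ k"
  show ?case
  proof (cases n)
    case 0
    then show ?thesis
      using insert insert.IH[of 0] by (simp add: elsym_insert)
  next
    case (Suc m)
    have "(\<Sum>i\<le>Suc m. (-1) ^ i * elsym x (insert a I) (Suc m - i) * (\<Sum>j\<in>insert a I. x j ^ Suc i)) =
      (\<Sum>i\<le>m. (-1) ^ i * (?e (Suc m - i) + x a * ?e (m - i)) * (?p (Suc i) + x a ^ Suc i)) +
      (-1) ^ Suc m * (?p (Suc (Suc m)) + x a ^ Suc (Suc m))"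
      using insert by (simp add: elsym_insert Suc_diff_le add.commute)
    also have "\<dots> = ((\<Sum>i\<le>m. (-1) ^ i * ?e (Suc m - i) * ?p (Suc i)) + (-1) ^ Suc m * ?p (Suc (Suc m)))
      + x a * (\<Sum>i\<le>m. (-1) ^ i * ?e (m - i) * ?p (Suc i))
      + ((\<Sum>i\<le>m. (-1) ^ i * ?e (Suc m - i) * x a ^ Suc i) + (-1) ^ Suc m * x a ^ Suc (Suc m))
      + (\<Sum>i\<le>m. (-1) ^ i * ?e (m - i) * x a ^ Suc (Suc i))"
      by (simp add: algebra_simps sum.distrib sum_distrib_left)
    also have "(\<Sum>i\<le>m. (-1) ^ i * ?e (Suc m - i) * ?p (Suc i)) + (-1) ^ Suc m * ?p (Suc (Suc m)) =
        of_nat (Suc (Suc m)) * ?e (Suc (Suc m))"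
      unfolding insert.IH using insert.hyps by simp
    also have "(\<Sum>i\<le>m. (-1) ^ i * ?e (m - i) * ?p (Suc i)) = of_nat (Suc m) * ?e (Suc m)"
      unfolding insert.IH ..
    also have "(\<Sum>i\<le>m. (-1) ^ i * ?e (Suc m - i) * x a ^ Suc i) + (-1) ^ Suc m * x a ^ Suc (Suc m) =
        (\<Sum>i\<le>Suc m. (-1) ^ i * ?e (Suc m - i) * x a ^ Suc i)"
      using insert.hyps by simp
    also have "\<dots> = ?e (Suc m) * x a - (\<Sum>i\<le>m. (-1) ^ i * ?e (m - i) * x a ^ Suc (Suc i))"
      by (subst sum.atMost_Suc_shift) (simp add: sum_negf)
    finally show ?thesis
      using insert Suc by (simp add: elsym_insert algebra_simps)
  qed
qed

subsection \<open>The main theorem on symmetric polynomials\<close>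

abbreviation swp :: "'v \<Rightarrow> 'v \<Rightarrow> 'v \<Rightarrow> 'v" where
  "swp a b v \<equiv> (if v = a then b else if v = b then a else v)"

text \<open>Transpositions generate the symmetric group on finite \<open>I\<close>, so this is full
  symmetry there; variables outside \<open>I\<close> are fixed and act as parameters.\<close>

definition symmetric_in :: "'v set \<Rightarrow> 'v zpoly \<Rightarrow> bool" where
  "symmetric_in I p \<longleftrightarrow> (\<forall>a\<in>I. \<forall>b\<in>I. zsubst (\<lambda>v. zvar (swp a b v)) p = p)"

lemma symmetric_in_ring_hull:
  assumes "p \<in> ring_hull G" "\<And>g. g \<in> G \<Longrightarrow> symmetric_in I g"
  shows "symmetric_in I p"
  using assms(1) by induction (use assms(2) in \<open>auto simp: symmetric_in_def\<close>)

lemma elsym_permute: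
  assumes "finite I" "bij_betw h I I"
  shows "elsym (\<lambda>i. x (h i)) I k = elsym x I k"
  using elsym_image[of I h x k] assms by (simp add: bij_betw_def)

lemma bij_betw_swp: "a \<in> I \<Longrightarrow> b \<in> I \<Longrightarrow> bij_betw (swp a b) I I"
  by (rule bij_betw_byWitness[where f' = "swp a b"]) auto

lemma symmetric_in_elsym: "finite I \<Longrightarrow> symmetric_in I (elsym zvar I k)"
  unfolding symmetric_in_def using elsym_permute[OF _ bij_betw_swp, of I _ _ zvar k] by simp

text \<open>Adjoining an element with a monic equation of degree \<open>n\<close> gives a module
  spanned by its powers below \<open>n\<close>. That span \<open>M\<close> is closed under
  multiplication by \<open>x\<close>, hence by Horner's scheme under multiplication by any
  polynomial in \<open>x\<close>, so it is the whole ring.\<close>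

lemma ring_hull_adjoin_integral:
  fixes x :: "'a :: comm_ring_1"
  assumes n: "n > 0" and r: "degree r < n" "\<And>i. coeff r i \<in> ring_hull G" "x ^ n = poly r x"
    and p: "p \<in> ring_hull (insert x G)"
  shows "\<exists>c. p = poly c x \<and> degree c < n \<and> (\<forall>i. coeff c i \<in> ring_hull G)"
proof -
  define M where "M = {poly c x |c. degree c < n \<and> (\<forall>i. coeff c i \<in> ring_hull G)}"
  have const: "a \<in> M" if "a \<in> ring_hull G" for a
  proof -
    have "\<forall>i. coeff [:a:] i \<in> ring_hull G"
      using that by (auto simp: coeff_pCons ring_hull_0 split: nat.split)
    then show ?thesis unfolding M_def using n by (auto intro!: exI[of _ "[:a:]"])
  qed
  have add: "a + b \<in> M" if "a \<in> M" "b \<in> M" for a b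
  proof -
    from that obtain c d where "a = poly c x" "degree c < n" "\<forall>i. coeff c i \<in> ring_hull G"
      "b = poly d x" "degree d < n" "\<forall>i. coeff d i \<in> ring_hull G"
      by (auto simp: M_def)
    then show ?thesis unfolding M_def
      by (auto intro!: exI[of _ "c + d"] degree_add_less ring_hull.add)
  qed
  have scale: "h * a \<in> M" if "h \<in> ring_hull G" "a \<in> M" for h a
  proof -
    from that(2) obtain c where "a = poly c x" "degree c < n" "\<forall>i. coeff c i \<in> ring_hull G"
      by (auto simp: M_def)
    then show ?thesis unfolding M_def using that(1)
      by (auto intro!: exI[of _ "smult h c"] ring_hull.mult le_less_trans[OF degree_smult_le])
  qed
  have shift: "x * a \<in> M" if "a \<in> M" for a
  proof -
    from that obtain c where c: "a = poly c x" "degree c < n" "\<forall>i. coeff c i \<in> ring_hull G"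
      by (auto simp: M_def)
    define k where "k = coeff c (n - 1)"
    \<comment> \<open>Multiplication by \<open>x\<close> can create a term of degree
      \<open>n\<close>; it is removed and replaced by \<open>k\<close> times the right-hand side
      \<open>r\<close> of the monic equation.\<close>
    define c' where "c' = pCons 0 c - monom k n + smult k r"
    have k: "k \<in> ring_hull G" using c by (simp add: k_def)
    have "poly c' x = x * a"
      using c r(3) by (simp add: c'_def poly_monom)
    moreover have "\<forall>i. coeff c' i \<in> ring_hull G"
      using c k r(2) unfolding c'_def
      by (auto simp: coeff_pCons ring_hull_0 split: nat.split
          intro!: ring_hull.add ring_hull_diff ring_hull.mult)
    moreover have "coeff c' i = 0" if "i \<ge> n" for i
      using that c(2) r(1) n unfolding c'_def k_def
      by (cases i) (auto simp: coeff_pCons coeff_eq_0)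
    then have "degree c' < n"
      using n by (intro le_less_trans[OF degree_le[of "n - 1"]]) auto
    ultimately show ?thesis unfolding M_def by (auto intro!: exI[of _ c'])
  qed
  have poly_mult: "poly c x * a \<in> M" if "\<forall>i. coeff c i \<in> ring_hull G" "a \<in> M" for c a
    using that(1)
  proof (induction c)
    case 0
    show ?case using const[OF ring_hull_0] by simp
  next
    case (pCons h c)
    have "h \<in> ring_hull G" "\<forall>i. coeff c i \<in> ring_hull G"
      using pCons.prems by (metis coeff_pCons_0, metis coeff_pCons_Suc)
    then have "h * a + x * (poly c x * a) \<in> M"
      using pCons.IH that(2) add scale shift by blast
    then show ?case by (simp add: algebra_simps)
  qed
  have x: "x \<in> M"
    using shift[OF const[OF ring_hull.one]] by simp
  from p have "p \<in> M"
  proof induction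
    case (base g)
    then show ?case using x const ring_hull.base by blast
  next
    case one
    show ?case by (rule const[OF ring_hull.one])
  next
    case (uminus p)
    then show ?case using scale[of "-1" p] by (simp add: ring_hull.one ring_hull.uminus)
  next
    case (add p q)
    then show ?case using \<open>\<And>a b. a \<in> M \<Longrightarrow> b \<in> M \<Longrightarrow> a + b \<in> M\<close> by blast
  next
    case (mult p q)
    then show ?case using poly_mult by (auto simp: M_def)
  qed
  then show ?thesis by (auto simp: M_def)
qed

lemma zsubst_poly: "zsubst f (poly q y) = poly (map_poly (zsubst f) q) (zsubst f y)"
  by (induction q) (auto simp: map_poly_pCons)

lemma zvar_eq_iff [simp]: "zvar a = zvar b \<longleftrightarrow> a = b"
  by (auto simp: zvar_def dest!: arg_cong[of _ _ Poly_Mapping.keys])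

text \<open>
  The induction removes one variable \<open>X\<^sub>a\<close>. The elementary symmetric functions of the others are
  polynomials in \<open>X\<^sub>a\<close> and those of all, so \<open>p = c(X\<^sub>a)\<close> with \<open>deg c < |I|\<close> and symmetric
  coefficients. By symmetry \<open>c - p\<close> has the \<open>|I|\<close> roots \<open>X\<^sub>b\<close>, hence vanishes.
\<close>

theorem symmetric_in_ring_hull_elsym:
  fixes p :: "'v :: linorder zpoly"
  assumes "finite I" "\<And>g. g \<in> G \<Longrightarrow> symmetric_in I g" "symmetric_in I p"
    and "p \<in> ring_hull (G \<union> zvar ` I)"
  shows "p \<in> ring_hull (G \<union> range (elsym zvar I))"
  using assms
proof (induction I arbitrary: G rule: finite_induct)
  case empty
  then show ?case
    using ring_hull_least[of "G \<union> zvar ` {}" "G \<union> range (elsym zvar {})"]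
    by (auto intro: ring_hull.base)
next
  case (insert a I)
  let ?J = "insert a I"
  define H where "H = G \<union> range (elsym zvar ?J)"
  define n where "n = card ?J"
  have n: "n = Suc (card I)" using insert by (simp add: n_def)
  have H_sym: "symmetric_in ?J g" if "g \<in> ring_hull H" for g
    by (rule symmetric_in_ring_hull[OF that])
      (use insert.prems(1) insert.hyps in \<open>auto simp: H_def intro: symmetric_in_elsym\<close>)
  \<comment> \<open>This is why \<open>G\<close> is arbitrary: the removed variable joins the
    coefficients, being symmetric in \<open>I\<close> because \<open>a\<close> is not in
    \<open>I\<close>.\<close>
  have "p \<in> ring_hull (insert (zvar a) G \<union> range (elsym zvar I))"
  proof (rule insert.IH)
    show "symmetric_in I g" if "g \<in> insert (zvar a) G" for g
      using that insert.prems(1) insert.hyps(2) by (fastforce simp: symmetric_in_def)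
    show "symmetric_in I p"
      using insert.prems(2) by (simp add: symmetric_in_def)
    show "p \<in> ring_hull (insert (zvar a) G \<union> zvar ` I)"
      using insert.prems(3) by simp
  qed
  moreover have "elsym zvar I k \<in> ring_hull (insert (zvar a) H)" for k
  proof (induction k)
    case 0
    show ?case using insert.hyps by (simp add: ring_hull.one)
  next
    case (Suc k)
    have "elsym zvar ?J (Suc k) - zvar a * elsym zvar I k \<in> ring_hull (insert (zvar a) H)"
      by (intro ring_hull_diff ring_hull.mult Suc.IH) (auto intro: ring_hull.base simp: H_def)
    then show ?case using insert.hyps by (simp add: elsym_insert)
  qed
  ultimately have p: "p \<in> ring_hull (insert (zvar a) H)"
    using ring_hull_least[of "insert (zvar a) G \<union> range (elsym zvar I)" "insert (zvar a) H"]
    by (auto simp: H_def intro: ring_hull.base)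
  \<comment> \<open>\<open>zvar a\<close> is a root of the monic polynomial with roots
    \<open>zvar i\<close> for \<open>i\<close> in \<open>?J\<close>; \<open>r\<close> is that
    equation solved for the top power. The relation comes from expanding a product whose factor at
    \<open>i = a\<close> is zero.\<close>
  define r where "r = - (\<Sum>k\<in>{1..n}. monom ((-1) ^ k * elsym zvar ?J k) (n - k))"
  have "(0 :: 'v zpoly) = (\<Prod>i\<in>?J. - zvar a + zvar i)"
    using insert.hyps by (simp add: prod_zero)
  also have "\<dots> = (\<Sum>k\<le>n. (- zvar a) ^ (n - k) * elsym zvar ?J k)"
    unfolding n_def by (rule prod_add_eq_elsym) (use insert.hyps in simp)
  finally have "0 = (-1) ^ n * (\<Sum>k\<le>n. (- zvar a) ^ (n - k) * elsym zvar ?J k)"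
    by simp
  also have "\<dots> = (\<Sum>k\<le>n. (-1) ^ k * elsym zvar ?J k * zvar a ^ (n - k))"
    unfolding sum_distrib_left
  proof (rule sum.cong[OF refl])
    fix k assume "k \<in> {..n}"
    then have "(-1 :: 'v zpoly) ^ n = (-1) ^ (n - k) * (-1) ^ k"
      by (simp flip: power_add)
    moreover have "(-1 :: 'v zpoly) ^ (n - k) * (-1) ^ (n - k) = 1"
      by (simp flip: power_mult_distrib)
    ultimately show "(-1) ^ n * ((- zvar a) ^ (n - k) * elsym zvar ?J k) =
        (-1) ^ k * elsym zvar ?J k * zvar a ^ (n - k)"
      by (simp only: power_minus[of "zvar a"] mult_ac) (simp add: mult.assoc[symmetric])
  qed
  also have "{..n} = insert 0 {1..n}" by auto
  finally have r_eq: "zvar a ^ n = poly r (zvar a)"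
    using insert.hyps by (simp add: r_def poly_sum poly_monom eq_neg_iff_add_eq_0)
  have "degree r < n"
    unfolding r_def degree_minus
    by (rule degree_sum_less) (use n in \<open>auto intro: le_less_trans[OF degree_monom_le]\<close>)
  moreover have "(-1) ^ k * elsym zvar ?J k \<in> ring_hull H" for k
    by (intro ring_hull.mult ring_hull_power ring_hull.uminus ring_hull.one ring_hull.base)
      (auto simp: H_def)
  then have "coeff r i \<in> ring_hull H" for i
    unfolding r_def coeff_minus coeff_sum coeff_monom
    by (intro ring_hull.uminus ring_hull_sum) (auto simp: ring_hull_0)
  ultimately obtain c where c: "p = poly c (zvar a)" "degree c < n" "\<And>i. coeff c i \<in> ring_hull H"
    using ring_hull_adjoin_integral[OF _ _ _ r_eq p] n by auto
  have "poly (c - [:p:]) (zvar b) = 0" if b: "b \<in> ?J" for b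
  proof -
    have "p = zsubst (\<lambda>v. zvar (swp a b v)) p"
      using insert.prems(2) b unfolding symmetric_in_def by auto
    also have "\<dots> = poly (map_poly (zsubst (\<lambda>v. zvar (swp a b v))) c) (zvar b)"
      unfolding c(1) zsubst_poly by simp
    also have "map_poly (zsubst (\<lambda>v. zvar (swp a b v))) c = c"
    proof (rule poly_eqI)
      fix i
      have "zsubst (\<lambda>v. zvar (swp a b v)) (coeff c i) = coeff c i"
        using H_sym[OF c(3), of i] b unfolding symmetric_in_def by blast
      then show "coeff (map_poly (zsubst (\<lambda>v. zvar (swp a b v))) c) i = coeff c i"
        by (simp add: coeff_map_poly)
    qed
    finally show ?thesis by simp
  qed
  then have "zvar ` ?J \<subseteq> {y. poly (c - [:p:]) y = 0}" by auto
  moreover have "card (zvar ` ?J :: 'v zpoly set) = n"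
    unfolding n_def by (rule card_image) (auto simp: inj_on_def)
  moreover have "degree (c - [:p:]) < n"
    by (rule degree_diff_less) (use c n in auto)
  \<comment> \<open>The root bound holds over integral domains; the linear order on
    \<open>'v\<close> makes \<open>'v zpoly\<close> one.\<close>
  ultimately have "c - [:p:] = 0"
    using card_poly_roots_bound[of "c - [:p:]"] card_mono[OF poly_roots_finite[of "c - [:p:]"], of "zvar ` ?J"]
    by linarith
  then have "p = coeff c 0" by simp
  with c(3) show ?case by (metis H_def)
qed

section \<open>The universal polynomials exist and are unique\<close>

text \<open>One variable \<open>v\<close> is split off: \<open>q\<close> is \<open>p\<close> as a
  univariate polynomial in \<open>v\<close>. Some coefficient of \<open>q\<close> survives
  specialisation of the other variables by induction, and a nonzero univariate complex polynomial
  has a non-root.\<close>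

lemma zpoly_nonvanishing:
  fixes p :: "'v zpoly"
  assumes "finite V" "p \<in> zpolys_in V" "p \<noteq> 0"
  shows "\<exists>c :: 'v \<Rightarrow> complex. zsubst c p \<noteq> 0"
  using assms
proof (induction V arbitrary: p rule: finite_induct)
  case empty
  then have "Poly_Mapping.keys p = {0}"
    using subset_singletonD[of "Poly_Mapping.keys p" 0] by (auto simp: zpolys_in_def)
  moreover from this have "Poly_Mapping.lookup p 0 \<noteq> 0"
    by (metis insertI1 in_keys_iff)
  ultimately show ?case
    by (simp add: zsubst_def)
next
  case (insert v V)
  define q where "q = zsubst (\<lambda>w. if w = v then [:0, 1:] else [:zvar w:]) p"
  have q: "poly q (zvar v) = p"
  proof -
    have "poly (zsubst (\<lambda>w. if w = v then [:0, 1:] else [:zvar w:]) p') (zvar v) = p'" for p' :: "'v zpoly"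
      by (induction p' rule: zpoly_induct) auto
    then show ?thesis by (simp add: q_def)
  qed
  have coeff_q: "coeff q i \<in> zpolys_in V" for i
    unfolding q_def using insert.prems(1)
  proof (induction arbitrary: i rule: zpolys_in_induct)
    case (zvar w)
    then show ?case by (auto simp: coeff_pCons zpolys_in_zvar split: nat.split)
  next
    case (mult p q)
    then show ?case by (auto simp: coeff_mult intro!: zpolys_in_sum zpolys_in_mult)
  qed (auto intro: zpolys_in_add zpolys_in_uminus simp: coeff_pCons split: nat.split)
  from q insert.prems(2) have "q \<noteq> 0" by auto
  then obtain i where "coeff q i \<noteq> 0" by (meson leading_coeff_neq_0)
  with insert.IH[OF coeff_q] obtain c :: "'v \<Rightarrow> complex" where c: "zsubst c (coeff q i) \<noteq> 0"
    by blast
  define q' where "q' = map_poly (zsubst c) q"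
  have "coeff q' i \<noteq> 0" using c by (simp add: q'_def coeff_map_poly)
  then have "q' \<noteq> 0" by auto
  then obtain z where z: "poly q' z \<noteq> 0"
    by (metis poly_all_0_iff_0)
  define c' where "c' = c(v := z)"
  have "zsubst c' p = poly (map_poly (zsubst c') q) (zsubst c' (zvar v))"
    by (simp only: zsubst_poly[symmetric] q)
  also have "map_poly (zsubst c') q = q'"
    unfolding q'_def
  proof (rule poly_eqI)
    fix j
    have "zsubst c' (coeff q j) = zsubst c (coeff q j)"
      by (rule zsubst_cong[OF coeff_q]) (use insert.hyps(2) in \<open>auto simp: c'_def\<close>)
    then show "coeff (map_poly (zsubst c') q) j = coeff (map_poly (zsubst c) q) j"
      by (simp add: coeff_map_poly)
  qed
  also have "zsubst c' (zvar v) = z" by (simp add: c'_def)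
  finally have "zsubst c' p \<noteq> 0" using z by metis
  then show ?case by blast
qed

lemma zpoly_eqI:
  fixes p q :: "'v zpoly"
  assumes "finite V" "p \<in> zpolys_in V" "q \<in> zpolys_in V"
    and "\<And>c :: 'v \<Rightarrow> complex. zsubst c p = zsubst c q"
  shows "p = q"
  using zpoly_nonvanishing[of V "p - q"] assms by (auto simp: zpolys_in_diff)

text \<open>Constant coefficient 1 keeps every root \<open>z\<close> away from 0, so its linear
  factor can be normalised to \<open>[:1, - 1 / z:]\<close>. A degree below \<open>n\<close> is
  padded by trivial factors with \<open>x i = 0\<close>.\<close>

lemma poly_eq_prod_linear:
  fixes q :: "complex poly"
  assumes "coeff q 0 = 1" "degree q \<le> n"
  shows "\<exists>x. q = (\<Prod>i\<in>{1..n}. [:1, x i:])"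
  using assms
proof (induction n arbitrary: q)
  case 0
  then have "q = 1" by (intro poly_eqI) (auto simp: coeff_eq_0 split: nat.split)
  then show ?case by simp
next
  case (Suc n)
  have "\<exists>y r. q = [:1, y:] * r \<and> coeff r 0 = 1 \<and> degree r \<le> n"
  proof (cases "degree q = 0")
    case True
    then have "q = 1" using Suc.prems by (metis degree_eq_zeroE coeff_pCons_0 one_pCons)
    then show ?thesis by (intro exI[of _ 0] exI[of _ 1]) simp
  next
    case False
    then have "\<not> constant (poly q)" by (simp add: constant_degree)
    then obtain z where z: "poly q z = 0"
      using fundamental_theorem_of_algebra by blast
    have "z \<noteq> 0" using z Suc.prems by (auto simp: poly_0_coeff_0)
    from z obtain r where r: "q = [:-z, 1:] * r"
      by (metis poly_eq_0_iff_dvd dvdE)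
    with False have "r \<noteq> 0" by auto
    have "[:1, - 1 / z:] = smult (- 1 / z) [:-z, 1:]"
      using \<open>z \<noteq> 0\<close> by simp
    then have "q = [:1, - 1 / z:] * smult (- z) r"
      using \<open>z \<noteq> 0\<close> by (simp only: r mult_smult_left mult_smult_right smult_smult) simp
    moreover have "coeff (smult (- z) r) 0 = 1"
      using Suc.prems(1) by (simp add: r)
    moreover have "degree (smult (- z) r) \<le> n"
      using Suc.prems(2) \<open>r \<noteq> 0\<close> \<open>z \<noteq> 0\<close> unfolding r by (subst (asm) degree_mult_eq) auto
    ultimately show ?thesis by blast
  qed
  then obtain y r where r: "q = [:1, y:] * r" "coeff r 0 = 1" "degree r \<le> n" by blast
  from Suc.IH[OF r(2,3)] obtain x where x: "r = (\<Prod>i\<in>{1..n}. [:1, x i:])" by blast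
  have "(\<Prod>i\<in>{1..n}. [:1, (x(Suc n := y)) i:]) = r"
    unfolding x by (rule prod.cong) auto
  moreover have "{1..Suc n} = insert (Suc n) {1..n}" by auto
  ultimately have "q = (\<Prod>i\<in>{1..Suc n}. [:1, (x(Suc n := y)) i:])"
    by (simp add: r(1) del: mult_pCons_left)
  then show ?case by blast
qed

lemma esym_surj:
  fixes c :: "nat \<Rightarrow> complex"
  shows "\<exists>x. \<forall>k\<in>{1..n}. esym x n k = c k"
proof -
  define q where "q = 1 + (\<Sum>k\<in>{1..n}. monom (c k) k)"
  have coeff_q: "coeff q k = (if k = 0 then 1 else if k \<le> n then c k else 0)" for k
    by (auto simp: q_def coeff_sum coeff_monom)
  then have "coeff q 0 = 1" by simp
  moreover have "degree q \<le> n"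
    by (rule degree_le) (simp add: coeff_q)
  ultimately obtain x where "q = (\<Prod>i\<in>{1..n}. [:1, x i:])"
    using poly_eq_prod_linear by blast
  then have "esym x n k = coeff q k" for k
    by (simp add: esym_eq_elsym coeff_prod_linear)
  then show ?thesis by (intro exI[of _ x]) (auto simp: coeff_q)
qed

text \<open>Every complex point is the tuple of elementary symmetric values of some
  \<open>x\<close>, so agreement after the substitution is agreement at all complex points.\<close>

lemma esym_independent:
  assumes "p \<in> zpolys_in {1..n}" "q \<in> zpolys_in {1..n}"
    and "zsubst (esym (zvar :: nat \<Rightarrow> nat zpoly) n) p = zsubst (esym zvar n) q"
  shows "p = q"
proof (rule zpoly_eqI[OF _ assms(1,2)])
  fix c :: "nat \<Rightarrow> complex"
  obtain x where x: "\<forall>k\<in>{1..n}. esym x n k = c k"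
    using esym_surj by blast
  have "zsubst c r = zsubst x (zsubst (esym zvar n) r)" if "r \<in> zpolys_in {1..n}" for r
    unfolding zsubst_zsubst
    by (rule zsubst_cong[OF that]) (use x in \<open>simp add: esym_eq_elsym\<close>)
  then show "zsubst c p = zsubst c q"
    using assms by metis
qed simp

lemma range_esym_subset_ring_hull: "range (esym x n) \<subseteq> ring_hull (esym x n ` {1..n})"
proof
  fix y assume "y \<in> range (esym x n)"
  then obtain k where k: "y = esym x n k" by auto
  show "y \<in> ring_hull (esym x n ` {1..n})"
  proof (cases "k \<in> {1..n}")
    case True
    then show ?thesis by (auto simp: k intro: ring_hull.base)
  next
    case False
    then have "k = 0 \<or> n < k" by auto
    then show ?thesis
      by (auto simp: k esym_eq_elsym elsym_eq_0 ring_hull_0 ring_hull.one)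
  qed
qed

text \<open>A transposition of the variables permutes the \<open>m\<close>-subsets and hence the
  products over them, so \<open>?p\<close> is symmetric. The symmetric function theorem then gives
  existence and algebraic independence gives uniqueness, which resolves the description.\<close>

lemma comp_poly:
  "comp_poly n m \<in> zpolys_in {1..n * m}" (is ?in)
  "zsubst (esym zvar (n * m)) (comp_poly n m) =
     elsym (\<lambda>J. \<Prod>k\<in>J. zvar k) {J. J \<subseteq> {1..n * m} \<and> card J = m} n" (is ?eq)
proof -
  let ?N = "{1..n * m}" and ?S = "{J. J \<subseteq> {1..n * m} \<and> card J = m}"
  let ?p = "elsym (\<lambda>J. \<Prod>k\<in>J. zvar k) ?S n :: nat zpoly"
  have fin: "finite ?S" by simp
  have p: "coeff (\<Prod>J\<in>?S. [:1, \<Prod>k\<in>J. zvar k:]) n = ?p"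
    by (rule coeff_prod_linear[OF fin])
  have "symmetric_in ?N ?p"
    unfolding symmetric_in_def
  proof (intro ballI)
    fix a b assume ab: "a \<in> ?N" "b \<in> ?N"
    define h where "h = swp a b"
    have h: "h (h v) = v" for v by (simp add: h_def)
    have h_in: "h v \<in> ?N" if "v \<in> ?N" for v using that ab by (simp add: h_def)
    have inj: "inj_on h J" for J
      by (metis h inj_onI)
    have "bij_betw ((`) h) ?S ?S"
    proof (rule bij_betw_byWitness[where f' = "(`) h"])
      have "h ` J \<in> ?S" if "J \<in> ?S" for J
        using that card_image[OF inj] h_in by blast
      then show "(`) h ` ?S \<subseteq> ?S" "(`) h ` ?S \<subseteq> ?S" by blast+
    qed (auto simp: image_image h)
    from elsym_permute[OF fin this, of "\<lambda>J. \<Prod>k\<in>J. zvar k" n]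
    have "zsubst (\<lambda>v. zvar (h v)) ?p = ?p"
      by (simp add: prod.reindex[OF inj] o_def)
    then show "zsubst (\<lambda>v. zvar (swp a b v)) ?p = ?p"
      by (simp add: h_def)
  qed
  moreover have "?p \<in> ring_hull ({} \<union> zvar ` ?N)"
    by (intro elsym_in_ring_hull ring_hull_prod ring_hull.base) auto
  ultimately have "?p \<in> ring_hull ({} \<union> range (elsym zvar ?N))"
    by (intro symmetric_in_ring_hull_elsym) auto
  then have "?p \<in> ring_hull (range (esym zvar (n * m)))"
    by (simp add: esym_eq_elsym[abs_def])
  then have "?p \<in> ring_hull (esym zvar (n * m) ` ?N)"
    using ring_hull_least[OF range_esym_subset_ring_hull] by blast
  then obtain P where P: "P \<in> zpolys_in ?N" "zsubst (esym zvar (n * m)) P = ?p"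
    unfolding ring_hull_image by auto
  have ex1: "\<exists>!P. P \<in> zpolys_in ?N \<and> zsubst (esym zvar (n * m)) P =
      coeff (\<Prod>J | J \<subseteq> ?N \<and> card J = m. [:1, \<Prod>k\<in>J. zvar k :: nat zpoly:]) n"
    unfolding p using P esym_independent by (intro ex1I[of _ P]) auto
  show ?in
    using theI'[OF ex1] unfolding comp_poly_def by blast
  show ?eq
    using theI'[OF ex1] unfolding comp_poly_def p by blast
qed

text \<open>The polynomial is symmetric in each group of variables separately. The symmetric
  function theorem is applied twice: to the first group with the second as coefficients, then to the
  second with the elementary symmetric functions of the first as coefficients.\<close>

lemma prod_poly:
  "prod_poly n \<in> zpolys_in ({1..n} <+> {1..n})" (is ?in)
  "zsubst (case_sum (esym (\<lambda>i. zvar (Inl i)) n) (esym (\<lambda>j. zvar (Inr j)) n)) (prod_poly n) =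
     elsym (\<lambda>(i, j). zvar (Inl i) * zvar (Inr j)) ({1..n} \<times> {1..n}) n" (is ?eq)
proof -
  let ?E = "case_sum (esym (\<lambda>i. zvar (Inl i)) n) (esym (\<lambda>j. zvar (Inr j)) n) :: nat + nat \<Rightarrow> (nat + nat) zpoly"
  let ?p = "elsym (\<lambda>(i, j). zvar (Inl i) * zvar (Inr j)) ({1..n} \<times> {1..n}) n :: (nat + nat) zpoly"
  have p: "coeff (\<Prod>i\<in>{1..n}. \<Prod>j\<in>{1..n}. [:1, zvar (Inl i) * zvar (Inr j):]) n = ?p"
    by (subst coeff_prod_linear[symmetric]) (auto simp: prod.cartesian_product intro!: arg_cong2[of _ _ _ _ coeff] prod.cong)
  \<comment> \<open>The symmetric function theorem asks for linearly ordered variables, so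
    \<open>Inl i\<close> and \<open>Inr j\<close> are coded as the integers \<open>i\<close> and
    \<open>- j\<close>; \<open>dec\<close> undoes this. Indices start at 1, so the codes do not
    collide.\<close>
  define I where "I = int ` {1..n}"
  define J where "J = (\<lambda>j. - int j) ` {1..n}"
  define dec where "dec z = (if z > 0 then Inl (nat z) else Inr (nat (- z)))" for z
  define p' where "p' = elsym (\<lambda>(i, j). zvar i * zvar j) (I \<times> J) n"
  have fin: "finite I" "finite J" "finite (I \<times> J)" by (auto simp: I_def J_def)
  have disj: "i \<notin> J" if "i \<in> I" for i
    using that by (auto simp: I_def J_def)
  have sym: "zsubst (\<lambda>v. zvar (swp a b v)) p' = p'"
    if ab: "a \<in> K" "b \<in> K" and K: "K = I \<or> K = J" for a b K
  proof -
    let ?h = "map_prod (swp a b) (swp a b)"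
    have "bij_betw ?h (I \<times> J) (I \<times> J)"
      by (rule bij_betw_byWitness[where f' = ?h]) (use ab K disj in auto)
    from elsym_permute[OF fin(3) this, of "\<lambda>(i, j). zvar i * zvar j" n] show ?thesis
      by (simp add: p'_def case_prod_unfold)
  qed
  have "p' \<in> ring_hull (zvar ` J \<union> zvar ` I)"
    unfolding p'_def by (intro elsym_in_ring_hull) (auto intro!: ring_hull.mult intro: ring_hull.base)
  then have "p' \<in> ring_hull (zvar ` J \<union> range (elsym zvar I))"
    using sym disj by (intro symmetric_in_ring_hull_elsym) (auto simp: symmetric_in_def fin)
  then have "p' \<in> ring_hull (range (elsym zvar I) \<union> zvar ` J)"
    by (simp add: Un_commute)
  moreover have "symmetric_in J (elsym zvar I k)" for k
    unfolding symmetric_in_def using disj by (auto intro!: elsym_cong)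
  ultimately have "p' \<in> ring_hull (range (elsym zvar I) \<union> range (elsym zvar J))"
    using sym by (intro symmetric_in_ring_hull_elsym) (auto simp: symmetric_in_def fin)
  moreover have "zsubst (\<lambda>z. zvar (dec z)) (elsym zvar I k) = esym (\<lambda>i. zvar (Inl i)) n k"
    "zsubst (\<lambda>z. zvar (dec z)) (elsym zvar J k) = esym (\<lambda>j. zvar (Inr j)) n k" for k
    unfolding I_def J_def esym_eq_elsym
    by (auto simp: elsym_image inj_on_def dec_def intro!: elsym_cong)
  moreover have "range (esym (\<lambda>i. zvar (Inl i)) n) \<subseteq> ring_hull (?E ` ({1..n} <+> {1..n}))"
    "range (esym (\<lambda>i. zvar (Inr i)) n) \<subseteq> ring_hull (?E ` ({1..n} <+> {1..n}))"
    by (rule order_trans[OF range_esym_subset_ring_hull ring_hull_least]; force intro: ring_hull.base)+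
  ultimately have "zsubst (\<lambda>z. zvar (dec z)) p' \<in> ring_hull (?E ` ({1..n} <+> {1..n}))"
    by (elim zsubst_ring_hull) auto
  also have "zsubst (\<lambda>z. zvar (dec z)) p' = ?p"
  proof -
    have "I \<times> J = map_prod int (\<lambda>j. - int j) ` ({1..n} \<times> {1..n})"
      by (auto simp: I_def J_def)
    then show ?thesis
      unfolding p'_def by (simp add: elsym_image inj_on_def case_prod_unfold)
        (auto simp: dec_def intro!: elsym_cong)
  qed
  finally obtain P where P: "P \<in> zpolys_in ({1..n} <+> {1..n})" "zsubst ?E P = ?p"
    unfolding ring_hull_image by auto
  have unique: "Q = P" if Q: "Q \<in> zpolys_in ({1..n} <+> {1..n})" "zsubst ?E Q = ?p" for Q
  proof (rule zpoly_eqI[OF _ Q(1) P(1)])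
    fix c :: "nat + nat \<Rightarrow> complex"
    obtain x where x: "\<forall>k\<in>{1..n}. esym x n k = c (Inl k)"
      using esym_surj[where c = "\<lambda>k. c (Inl k)"] by blast
    obtain y where y: "\<forall>k\<in>{1..n}. esym y n k = c (Inr k)"
      using esym_surj[where c = "\<lambda>k. c (Inr k)"] by blast
    have "zsubst c r = zsubst (case_sum x y) (zsubst ?E r)" if "r \<in> zpolys_in ({1..n} <+> {1..n})" for r
      unfolding zsubst_zsubst
      by (rule zsubst_cong[OF that]) (use x y in \<open>auto simp: esym_eq_elsym\<close>)
    then show "zsubst c Q = zsubst c P"
      using Q P by metis
  qed simp
  have ex1: "\<exists>!P. P \<in> zpolys_in ({1..n} <+> {1..n}) \<and> zsubst ?E P =
      coeff (\<Prod>i\<in>{1..n}. \<Prod>j\<in>{1..n}. [:1, zvar (Inl i) * zvar (Inr j):]) n"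
    unfolding p
  proof (rule ex1I[of _ P])
    show "Q = P" if "Q \<in> zpolys_in ({1..n} <+> {1..n}) \<and> zsubst ?E Q = ?p" for Q
      by (rule unique) (use that in blast)+
  qed (rule conjI[OF P])
  show ?in
    using theI'[OF ex1] unfolding prod_poly_def by blast
  show ?eq
    using theI'[OF ex1] unfolding prod_poly_def p by blast
qed

text \<open>In Newton's identity the highest power sum has coefficient 1 or -1, so solving for it
  keeps the coefficients integral.\<close>

lemma newton_poly_exists:
  "\<exists>P\<in>zpolys_in {1..n}. \<forall>m. zsubst (esym zvar m) P = (\<Sum>i\<in>{1..m}. zvar i ^ n :: nat zpoly)"
  if "n \<ge> 1"
  using that
proof (induction n rule: less_induct)
  case (less n)
  obtain k where n: "n = Suc k" using less.prems by (cases n) auto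
  have "\<forall>i\<in>{..<k}. \<exists>P. P \<in> zpolys_in {1..Suc i} \<and>
      (\<forall>m. zsubst (esym zvar m) P = (\<Sum>j\<in>{1..m}. zvar j ^ Suc i :: nat zpoly))"
    using less.IH n by (metis Suc_mono lessThan_iff le_add1 plus_1_eq_Suc)
  then obtain N where N: "\<And>i. i < k \<Longrightarrow> N i \<in> zpolys_in {1..Suc i}"
    "\<And>i m. i < k \<Longrightarrow> zsubst (esym zvar m) (N i) = (\<Sum>j\<in>{1..m}. zvar j ^ Suc i :: nat zpoly)"
    by (auto dest!: bchoice)
  define P where "P = (-1) ^ k * (of_nat n * zvar n - (\<Sum>i<k. (-1) ^ i * zvar (k - i) * N i))"
  have "P \<in> zpolys_in {1..n}"
    unfolding P_def
  proof (intro zpolys_in_mult zpolys_in_power zpolys_in_uminus zpolys_in_1 zpolys_in_diff zpolys_in_sum)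
    show "of_nat n \<in> zpolys_in {1..n}"
      using zpolys_in_of_int[of "int n"] by simp
    show "N i \<in> zpolys_in {1..n}" if "i \<in> {..<k}" for i
      using N(1)[of i] zpolys_in_mono[of "{1..Suc i}" "{1..n}"] that n by auto
  qed (auto simp: n intro!: zpolys_in_zvar)
  moreover have "zsubst (esym zvar m) P = (\<Sum>i\<in>{1..m}. zvar i ^ n :: nat zpoly)" for m
  proof -
    have "of_nat (Suc k) * esym zvar m (Suc k) - (\<Sum>i<k. (-1) ^ i * esym zvar m (k - i) * (\<Sum>j\<in>{1..m}. zvar j ^ Suc i)) =
        (-1) ^ k * (\<Sum>j\<in>{1..m}. zvar j ^ Suc k :: nat zpoly)"
      unfolding esym_eq_elsym using newton_identity[of "{1..m}" k zvar]
      by (simp add: lessThan_Suc_atMost[symmetric] del: power_Suc)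
    then have "zsubst (esym zvar m) P = (-1) ^ k * ((-1) ^ k * (\<Sum>j\<in>{1..m}. zvar j ^ Suc k))"
      unfolding P_def n by (simp add: N(2) del: power_Suc of_nat_Suc)
    moreover have "(-1 :: nat zpoly) ^ k * (-1) ^ k = 1"
      by (simp flip: power_mult_distrib)
    ultimately show ?thesis
      by (simp add: n mult.assoc[symmetric] del: power_Suc)
  qed
  ultimately show ?case by blast
qed

text \<open>The bound on the variables is what the depth estimate for \<open>Psi\<close> rests on.
  For uniqueness of the description the instance \<open>m = n\<close> decides.\<close>

lemma newton_poly:
  assumes "n \<ge> 1"
  shows "newton_poly n \<in> zpolys_in {1..n}"
proof -
  obtain P where P: "P \<in> zpolys_in {1..n}" "\<forall>m. zsubst (esym zvar m) P = (\<Sum>i\<in>{1..m}. zvar i ^ n :: nat zpoly)"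
    using newton_poly_exists[OF assms] by blast
  have "\<exists>!P. P \<in> zpolys_in {1..n} \<and> (\<forall>m. zsubst (esym zvar m) P = (\<Sum>i\<in>{1..m}. zvar i ^ n :: nat zpoly))"
  proof (rule ex1I[of _ P])
    fix Q assume "Q \<in> zpolys_in {1..n} \<and> (\<forall>m. zsubst (esym zvar m) Q = (\<Sum>i\<in>{1..m}. zvar i ^ n :: nat zpoly))"
    with P show "Q = P" by (intro esym_independent[of Q n P]) simp_all
  qed (use P in blast)
  from theI'[OF this] show ?thesis
    unfolding newton_poly_def by (rule conjunct1)
qed

section \<open>Inverting power series\<close>

text \<open>Coefficients of the inverse of a power series with constant term 1 and further
  coefficients \<open>zvar 1\<close>, \<open>zvar 2\<close>, ...; the recursion says that the
  coefficient of index \<open>Suc n\<close> in the product vanishes.\<close>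

fun inverse_poly :: "nat \<Rightarrow> nat zpoly" where
  "inverse_poly 0 = 1"
| "inverse_poly (Suc n) = - (\<Sum>i\<le>n. zvar (Suc i) * inverse_poly (n - i))"

lemma inverse_poly_in: "inverse_poly n \<in> zpolys_in {1..n}"
proof (induction n rule: less_induct)
  case (less n)
  show ?case
  proof (cases n)
    case (Suc m)
    have "inverse_poly (m - i) \<in> zpolys_in {1..n}" for i
      by (rule subsetD[OF zpolys_in_mono less]) (use Suc in auto)
    then show ?thesis
      using Suc by (auto intro!: zpolys_in_uminus zpolys_in_sum zpolys_in_mult zpolys_in_zvar)
  qed simp
qed

definition convol :: "('a, 'm) ring_scheme \<Rightarrow> (nat \<Rightarrow> 'a) \<Rightarrow> (nat \<Rightarrow> 'a) \<Rightarrow> nat \<Rightarrow> 'a" where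
  "convol R f g n = (\<Oplus>\<^bsub>R\<^esub>i\<in>{0..n}. f i \<otimes>\<^bsub>R\<^esub> g (n - i))"

definition delta :: "('a, 'm) ring_scheme \<Rightarrow> nat \<Rightarrow> 'a" where
  "delta R n = (if n = 0 then \<one>\<^bsub>R\<^esub> else \<zero>\<^bsub>R\<^esub>)"

definition alternating :: "('a, 'm) ring_scheme \<Rightarrow> (nat \<Rightarrow> 'a) \<Rightarrow> nat \<Rightarrow> 'a" where
  "alternating R f i = (\<ominus>\<^bsub>R\<^esub> \<one>\<^bsub>R\<^esub>) [^]\<^bsub>R\<^esub> i \<otimes>\<^bsub>R\<^esub> f i"

context cring
begin

lemma convol_0:
  assumes "\<And>i. f i \<in> carrier R" "\<And>i. g i \<in> carrier R"
  shows "convol R f g 0 = f 0 \<otimes> g 0"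
  using assms by (simp add: convol_def)

lemma convol_Suc:
  assumes "\<And>i. f i \<in> carrier R" "\<And>i. g i \<in> carrier R"
  shows "convol R f g (Suc n) = (\<Oplus>i\<in>{..n}. f (Suc i) \<otimes> g (n - i)) \<oplus> f 0 \<otimes> g (Suc n)"
  unfolding convol_def atLeast0AtMost by (subst finsum_Suc2) (use assms in auto)

lemma convol_commute:
  assumes f: "\<And>i. f i \<in> carrier R" and g: "\<And>i. g i \<in> carrier R"
  shows "convol R f g n = convol R g f n"
proof -
  have "(\<lambda>i. n - i) ` {0..n} = {0..n}"
  proof (intro equalityI subsetI)
    fix i assume "i \<in> {0..n}"
    then show "i \<in> (\<lambda>i. n - i) ` {0..n}"
      by (intro image_eqI[of _ _ "n - i"]) auto
  qed auto
  then have "convol R f g n = (\<Oplus>i\<in>(\<lambda>i. n - i) ` {0..n}. f i \<otimes> g (n - i))"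
    by (simp add: convol_def)
  also have "\<dots> = (\<Oplus>i\<in>{0..n}. f (n - i) \<otimes> g (n - (n - i)))"
    by (rule finsum_reindex) (use f g in \<open>auto simp: inj_on_def\<close>)
  also have "\<dots> = convol R g f n"
    unfolding convol_def by (rule finsum_cong'[OF refl]) (use f g m_comm in auto)
  finally show ?thesis .
qed

text \<open>As \<open>f 0 = \<one>\<close>, the coefficient of index \<open>n\<close> of the product
  is \<open>g n\<close> plus a combination of earlier values of \<open>g\<close>.\<close>

lemma convol_cancel:
  assumes f: "\<And>i. f i \<in> carrier R" and g: "\<And>i. g i \<in> carrier R" and h: "\<And>i. h i \<in> carrier R"
    and f0: "f 0 = \<one>" and eq: "\<And>n. convol R f g n = convol R f h n"
  shows "g n = h n"
proof (induction n rule: less_induct)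
  case (less n)
  show ?case
  proof (cases n)
    case 0
    then show ?thesis using eq[of 0] f0 f g h by (simp add: convol_0)
  next
    case (Suc m)
    have "(\<Oplus>i\<in>{..m}. f (Suc i) \<otimes> g (m - i)) = (\<Oplus>i\<in>{..m}. f (Suc i) \<otimes> h (m - i))"
      by (rule finsum_cong') (use less Suc f h in auto)
    then show ?thesis
      using eq[of n] f g h by (simp add: Suc convol_Suc f0)
  qed
qed

lemma convol_inverse_poly:
  assumes f: "\<And>i. f i \<in> carrier R" and f0: "f 0 = \<one>"
  shows "convol R f (\<lambda>n. zeval R f (inverse_poly n)) n = delta R n"
proof (cases n)
  case 0
  then show ?thesis using f f0 by (simp add: convol_0 delta_def)
next
  case (Suc m)
  then show ?thesis
    using f f0 by (simp add: convol_Suc delta_def zeval_uminus zeval_sum zeval_mult r_neg)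
qed

lemma convol_inverse_unique:
  assumes "\<And>i. f i \<in> carrier R" "\<And>i. g i \<in> carrier R" "f 0 = \<one>" "\<And>n. convol R f g n = delta R n"
  shows "g n = zeval R f (inverse_poly n)"
  by (rule convol_cancel[of f]) (use assms convol_inverse_poly in auto)

text \<open>The description behind \<open>inv\<close> is resolved on coefficients: the recursion of
  \<open>inverse_poly\<close> supplies an inverse, and cancellation shows that it is the only
  one.\<close>

lemma power_series_inv:
  assumes f: "\<And>i. f i \<in> carrier R" and f0: "f 0 = \<one>"
  shows "(inv\<^bsub>power_series_ring R\<^esub> f) = (\<lambda>n. zeval R f (inverse_poly n))" (is "_ = ?g")
  unfolding m_inv_def
proof (rule the_equality)
  have mult: "a \<otimes>\<^bsub>power_series_ring R\<^esub> b = convol R a b" for a b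
    by (simp add: power_series_ring_def convol_def fun_eq_iff)
  have one: "\<one>\<^bsub>power_series_ring R\<^esub> = delta R"
    by (simp add: power_series_ring_def delta_def fun_eq_iff)
  have car: "a \<in> carrier (power_series_ring R) \<longleftrightarrow> (\<forall>n. a n \<in> carrier R)" for a
    by (simp add: power_series_ring_def)
  show "?g \<in> carrier (power_series_ring R) \<and> f \<otimes>\<^bsub>power_series_ring R\<^esub> ?g = \<one>\<^bsub>power_series_ring R\<^esub> \<and>
      ?g \<otimes>\<^bsub>power_series_ring R\<^esub> f = \<one>\<^bsub>power_series_ring R\<^esub>"
    unfolding mult one car fun_eq_iff
    using f f0 convol_inverse_poly[of f] convol_commute[of f ?g] by simp
  fix y assume "y \<in> carrier (power_series_ring R) \<and> f \<otimes>\<^bsub>power_series_ring R\<^esub> y = \<one>\<^bsub>power_series_ring R\<^esub> \<and>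
      y \<otimes>\<^bsub>power_series_ring R\<^esub> f = \<one>\<^bsub>power_series_ring R\<^esub>"
  then show "y = ?g"
    unfolding mult one car fun_eq_iff using convol_inverse_unique[of f y] f f0 by auto
qed

lemma alternating_closed [simp]: "f i \<in> carrier R \<Longrightarrow> alternating R f i \<in> carrier R"
  by (simp add: alternating_def)

lemma minus_one_power: "(\<ominus> \<one>) [^] (i :: nat) = (if even i then \<one> else \<ominus> \<one>)"
  by (induction i) (auto simp: l_minus)

lemma alternating_eq: "f i \<in> carrier R \<Longrightarrow> alternating R f i = (if even i then f i else \<ominus> f i)"
  by (auto simp: alternating_def minus_one_power l_minus)

lemma opposite_eq:
  assumes "\<And>i. l i x \<in> carrier R" "l 0 x = \<one>"
  shows "opposite R l n x = zeval R (alternating R (\<lambda>i. l i x)) (inverse_poly n)"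
proof -
  have "(\<lambda>i. (\<ominus> \<one>) [^] i \<otimes> l i x) = alternating R (\<lambda>i. l i x)"
    by (simp add: alternating_def fun_eq_iff)
  then show ?thesis
    unfolding opposite_def using assms by (simp add: power_series_inv alternating_eq)
qed

end

section \<open>Consequences of the \<lambda>-ring axioms for zero and negatives\<close>

locale lam_ring = cring R for R (structure) +
  fixes \<tau> :: "nat \<Rightarrow> 'a \<Rightarrow> 'a"
  assumes lambda_ring: "lambda_ring R \<tau>"
begin

lemma op_closed [simp]: "x \<in> carrier R \<Longrightarrow> \<tau> i x \<in> carrier R"
  and op_0 [simp]: "x \<in> carrier R \<Longrightarrow> \<tau> 0 x = \<one>"
  and op_1: "x \<in> carrier R \<Longrightarrow> \<tau> 1 x = x"
  and op_add: "x \<in> carrier R \<Longrightarrow> y \<in> carrier R \<Longrightarrow> \<tau> n (x \<oplus> y) = convol R (\<lambda>i. \<tau> i x) (\<lambda>i. \<tau> i y) n"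
  using lambda_ring by (auto simp: lambda_ring_def convol_def Pi_iff)

text \<open>From 0 + 0 = 0 the series of \<open>\<zero>\<close> equals its own square; its constant
  term is 1, so it can be cancelled, leaving the series 1.\<close>

lemma op_zero: "\<tau> n \<zero> = delta R n"
proof -
  have "(\<lambda>i. \<tau> i \<zero>) n = delta R n"
  proof (rule convol_cancel[of "\<lambda>i. \<tau> i \<zero>"])
    fix n
    have "convol R (\<lambda>i. \<tau> i \<zero>) (delta R) n = convol R (delta R) (\<lambda>i. \<tau> i \<zero>) n"
      by (rule convol_commute) (auto simp: delta_def)
    also have "\<dots> = \<tau> n \<zero>"
    proof (cases n)
      case 0
      show ?thesis unfolding 0 by (subst convol_0) (auto simp: delta_def)
    next
      case (Suc m)
      have "(\<Oplus>i\<in>{..m}. delta R (Suc i) \<otimes> \<tau> (m - i) \<zero>) = \<zero>"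
        by (rule add.finprod_one_eqI) (auto simp: delta_def)
      then show ?thesis unfolding Suc by (subst convol_Suc) (auto simp: delta_def)
    qed
    also have "\<dots> = convol R (\<lambda>i. \<tau> i \<zero>) (\<lambda>i. \<tau> i \<zero>) n"
      using op_add[of \<zero> \<zero> n] by simp
    finally show "convol R (\<lambda>i. \<tau> i \<zero>) (\<lambda>i. \<tau> i \<zero>) n = convol R (\<lambda>i. \<tau> i \<zero>) (delta R) n" ..
  qed (auto simp: delta_def)
  then show ?thesis .
qed

lemma op_add_uminus: "x \<in> carrier R \<Longrightarrow> convol R (\<lambda>i. \<tau> i x) (\<lambda>i. \<tau> i (\<ominus> x)) n = delta R n"
  using op_add[of x "\<ominus> x" n] by (simp add: r_neg op_zero)

lemma op_uminus: "x \<in> carrier R \<Longrightarrow> \<tau> n (\<ominus> x) = zeval R (\<lambda>i. \<tau> i x) (inverse_poly n)"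
  using convol_inverse_unique[of "\<lambda>i. \<tau> i x" "\<lambda>i. \<tau> i (\<ominus> x)" n] by (simp add: op_add_uminus)

end

section \<open>Reduction of terms to polynomials\<close>

locale T_model =
  fixes R :: "('a, 'm) ring_scheme" (structure) and l s \<psi> :: "nat \<Rightarrow> 'a \<Rightarrow> 'a"
  assumes model: "model_of_T R l s \<psi>"
begin

sublocale cring R
  using model by (simp add: model_of_T_def)

sublocale L: lam_ring R l
  by standard (use model in \<open>simp add: model_of_T_def\<close>)

sublocale S: lam_ring R s
  by standard (use model in \<open>simp add: model_of_T_def special_def\<close>)

lemma s_eq: "x \<in> carrier R \<Longrightarrow> s n x = zeval R (alternating R (\<lambda>i. l i x)) (inverse_poly n)"
  using model opposite_eq[of l x n] by (simp add: model_of_T_def)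

text \<open>Both \<open>?a\<close>, the series of \<lambda> at -t, and the \<sigma>-series of
  \<open>\<ominus> x\<close> are inverse to the \<sigma>-series of \<open>x\<close>, hence equal.
  Alternating the signs twice recovers \<open>l n x\<close>.\<close>

lemma l_eq:
  assumes x: "x \<in> carrier R"
  shows "l n x = alternating R (\<lambda>i. s i (\<ominus> x)) n"
proof -
  let ?a = "alternating R (\<lambda>i. l i x)"
  have a: "?a i \<in> carrier R" for i using x by simp
  have "convol R (\<lambda>i. s i x) ?a n = convol R ?a (\<lambda>i. s i x) n" for n
    by (rule convol_commute) (use x in auto)
  also have "\<dots> n = delta R n" for n
    using convol_inverse_poly[of ?a n] x by (simp add: s_eq[OF x] alternating_eq)
  finally have "?a n = s n (\<ominus> x)"
    using convol_cancel[of "\<lambda>i. s i x" ?a "\<lambda>i. s i (\<ominus> x)" n] x by (simp add: S.op_add_uminus)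
  then have "alternating R (\<lambda>i. s i (\<ominus> x)) n = alternating R ?a n"
    using x by (simp add: alternating_eq split: if_splits flip: \<open>?a n = s n (\<ominus> x)\<close>)
  also have "\<dots> = l n x"
    using x by (simp add: alternating_eq)
  finally show ?thesis ..
qed

lemma s_mult: "k \<ge> 1 \<Longrightarrow> x \<in> carrier R \<Longrightarrow> y \<in> carrier R \<Longrightarrow>
    s k (x \<otimes> y) = zeval R (case_sum (\<lambda>i. s i x) (\<lambda>i. s i y)) (prod_poly k)"
  and s_comp: "k \<ge> 1 \<Longrightarrow> m \<ge> 1 \<Longrightarrow> x \<in> carrier R \<Longrightarrow> s k (s m x) = zeval R (\<lambda>i. s i x) (comp_poly k m)"
  and s_one: "k \<ge> 2 \<Longrightarrow> s k \<one> = \<zero>"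
  and psi_eq: "k \<ge> 1 \<Longrightarrow> x \<in> carrier R \<Longrightarrow> \<psi> k x = zeval R (\<lambda>i. s i x) (newton_poly k)"
  using model by (auto simp: model_of_T_def special_def adams_def)

lemma interp_closed:
  assumes "\<forall>i\<in>{1..n}. r i \<in> carrier R"
  shows "term_in n \<phi> \<Longrightarrow> interp R l s \<psi> r \<phi> \<in> carrier R"
  by (induction \<phi>) (use assms in \<open>auto simp: psi_eq\<close>)

end

section \<open>Elimination of the \<lambda> and Adams symbols from terms\<close>

fun pure_term :: "lterm \<Rightarrow> bool" where
  "pure_term Zero \<longleftrightarrow> True"
| "pure_term One \<longleftrightarrow> True"
| "pure_term (Var i) \<longleftrightarrow> True"
| "pure_term (Neg a) \<longleftrightarrow> pure_term a"
| "pure_term (Add a b) \<longleftrightarrow> pure_term a \<and> pure_term b"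
| "pure_term (Mul a b) \<longleftrightarrow> pure_term a \<and> pure_term b"
| "pure_term (Lam k a) \<longleftrightarrow> False"
| "pure_term (Sig k a) \<longleftrightarrow> pure_term a"
| "pure_term (Psi k a) \<longleftrightarrow> False"

definition term_equiv :: "'a itself \<Rightarrow> nat \<Rightarrow> lterm \<Rightarrow> lterm \<Rightarrow> bool" where
  "term_equiv TA n \<phi> u \<longleftrightarrow>
     (\<forall>(R :: 'a ring) l s \<psi> r. model_of_T R l s \<psi> \<longrightarrow> (\<forall>i\<in>{1..n}. r i \<in> carrier R) \<longrightarrow>
        interp R l s \<psi> r \<phi> = interp R l s \<psi> r u)"

definition poly_equiv :: "'a itself \<Rightarrow> nat \<Rightarrow> lterm \<Rightarrow> nat zpoly \<Rightarrow> lterm \<Rightarrow> bool" where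
  "poly_equiv TA n a p u \<longleftrightarrow>
     (\<forall>(R :: 'a ring) l s \<psi> r. model_of_T R l s \<psi> \<longrightarrow> (\<forall>i\<in>{1..n}. r i \<in> carrier R) \<longrightarrow>
        interp R l s \<psi> r u = zeval R (\<lambda>i. s i (interp R l s \<psi> r a)) p)"

lemma poly_equivI:
  fixes TA :: "'a itself"
  assumes "term_in n a"
    and "\<And>(R :: 'a ring) l s \<psi> r. cring R \<Longrightarrow> model_of_T R l s \<psi> \<Longrightarrow> \<forall>i\<in>{1..n}. r i \<in> carrier R \<Longrightarrow>
      (\<And>i. s i (interp R l s \<psi> r a) \<in> carrier R) \<Longrightarrow>
      interp R l s \<psi> r u = zeval R (\<lambda>i. s i (interp R l s \<psi> r a)) p"
  shows "poly_equiv TA n a p u"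
  unfolding poly_equiv_def
proof safe
  fix R :: "'a ring" and l s \<psi> r
  assume mr: "model_of_T R l s \<psi>" "\<forall>i\<in>{1..n}. r i \<in> carrier R"
  then interpret T_model R l s \<psi> by unfold_locales
  show "interp R l s \<psi> r u = zeval R (\<lambda>i. s i (interp R l s \<psi> r a)) p"
    by (rule assms(2)[OF is_cring mr]) (use interp_closed[OF mr(2) assms(1)] in simp)
qed

lemma
  assumes "term_in n a"
  shows poly_equiv_zvar: "poly_equiv TA n a (zvar k) (Sig k a)"
    and poly_equiv_one: "poly_equiv TA n a 1 One"
    and poly_equiv_uminus: "poly_equiv TA n a p u \<Longrightarrow> poly_equiv TA n a (- p) (Neg u)"
    and poly_equiv_add: "poly_equiv TA n a p u \<Longrightarrow> poly_equiv TA n a q v \<Longrightarrow> poly_equiv TA n a (p + q) (Add u v)"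
    and poly_equiv_mult: "poly_equiv TA n a p u \<Longrightarrow> poly_equiv TA n a q v \<Longrightarrow> poly_equiv TA n a (p * q) (Mul u v)"
  by (rule poly_equivI[OF assms], simp add: poly_equiv_def cring.zeval_zvar cring.zeval_1
      cring.zeval_uminus cring.zeval_add cring.zeval_mult)+

text \<open>With the Newton polynomial for \<open>p\<close>, this replaces an Adams operation by a
  term in \<sigma>-operations. A variable \<open>v \<le> m\<close> becomes \<open>Sig v a\<close>,
  which accounts for the factor \<open>m\<close> in the depth.\<close>

lemma zpoly_as_term:
  fixes TA :: "'a itself" and TB :: "'b itself"
  assumes a: "pure_term a" "term_in n a" and p: "p \<in> zpolys_in {1..m}"
  shows "\<exists>u. pure_term u \<and> term_in n u \<and> (\<forall>i. depth u i \<le> m * depth a i) \<and>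
    poly_equiv TA n a p u \<and> poly_equiv TB n a p u"
  using p
proof (induction rule: zpolys_in_induct)
  case (zvar v)
  then show ?case
    using a by (intro exI[of _ "Sig v a"]) (auto intro!: poly_equiv_zvar)
next
  case one
  show ?case
    using a by (intro exI[of _ One]) (auto intro!: poly_equiv_one)
next
  case (uminus p)
  then obtain u where "pure_term u \<and> term_in n u \<and> (\<forall>i. depth u i \<le> m * depth a i) \<and>
    poly_equiv TA n a p u \<and> poly_equiv TB n a p u" by blast
  then show ?case
    using a by (intro exI[of _ "Neg u"]) (auto intro!: poly_equiv_uminus)
next
  case (add p q)
  then obtain u v where "pure_term u \<and> term_in n u \<and> (\<forall>i. depth u i \<le> m * depth a i) \<and>
      poly_equiv TA n a p u \<and> poly_equiv TB n a p u"
    "pure_term v \<and> term_in n v \<and> (\<forall>i. depth v i \<le> m * depth a i) \<and>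
      poly_equiv TA n a q v \<and> poly_equiv TB n a q v" by blast
  then show ?case
    using a by (intro exI[of _ "Add u v"]) (auto intro!: poly_equiv_add)
next
  case (mult p q)
  then obtain u v where "pure_term u \<and> term_in n u \<and> (\<forall>i. depth u i \<le> m * depth a i) \<and>
      poly_equiv TA n a p u \<and> poly_equiv TB n a p u"
    "pure_term v \<and> term_in n v \<and> (\<forall>i. depth v i \<le> m * depth a i) \<and>
      poly_equiv TA n a q v \<and> poly_equiv TB n a q v" by blast
  then show ?case
    using a by (intro exI[of _ "Mul u v"]) (auto intro!: poly_equiv_mult)
qed

lemma term_equiv_Lam:
  assumes "term_in n a"
  shows "term_equiv TA n (Lam k a) (if even k then Sig k (Neg a) else Neg (Sig k (Neg a)))"
  unfolding term_equiv_def
proof safe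
  fix R :: "'a ring" and l s \<psi> r
  assume "model_of_T R l s \<psi>" and r: "\<forall>i\<in>{1..n}. r i \<in> carrier R"
  then interpret T_model R l s \<psi> by unfold_locales
  show "interp R l s \<psi> r (Lam k a) =
      interp R l s \<psi> r (if even k then Sig k (Neg a) else Neg (Sig k (Neg a)))"
    using interp_closed[OF r assms] by (simp add: l_eq alternating_eq)
qed

lemma term_equiv_Psi:
  assumes "term_in n a" "k \<ge> 1" "poly_equiv TA n a (newton_poly k) u"
  shows "term_equiv TA n (Psi k a) u"
  unfolding term_equiv_def
proof safe
  fix R :: "'a ring" and l s \<psi> r
  assume mr: "model_of_T R l s \<psi>" "\<forall>i\<in>{1..n}. r i \<in> carrier R"
  then interpret T_model R l s \<psi> by unfold_locales
  show "interp R l s \<psi> r (Psi k a) = interp R l s \<psi> r u"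
    using interp_closed[OF mr(2) assms(1)] assms(2,3) mr by (simp add: psi_eq poly_equiv_def)
qed

lemma term_equiv_trans: "term_equiv TA n a b \<Longrightarrow> term_equiv TA n b c \<Longrightarrow> term_equiv TA n a c"
  by (simp add: term_equiv_def)

lemma term_equiv_cong:
  assumes "term_equiv TA n a a'"
  shows "term_equiv TA n (Neg a) (Neg a')" "term_equiv TA n (Sig k a) (Sig k a')"
    "term_equiv TA n (Lam k a) (Lam k a')" "term_equiv TA n (Psi k a) (Psi k a')"
    "term_equiv TA n b b' \<Longrightarrow> term_equiv TA n (Add a b) (Add a' b')"
    "term_equiv TA n b b' \<Longrightarrow> term_equiv TA n (Mul a b) (Mul a' b')"
  using assms by (simp_all add: term_equiv_def)

text \<open>The claim is made for two types at once, because the term \<open>u\<close> must not depend on the type and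
  HOL cannot quantify over types.\<close>

lemma term_equiv_pure:
  fixes TA :: "'a itself" and TB :: "'b itself"
  assumes "term_in n \<phi>"
  shows "\<exists>u. pure_term u \<and> term_in n u \<and> (\<forall>i. depth u i \<le> depth \<phi> i) \<and>
    term_equiv TA n \<phi> u \<and> term_equiv TB n \<phi> u"
  using assms
proof (induction \<phi>)
  case Zero
  then show ?case by (intro exI[of _ Zero]) (simp add: term_equiv_def)
next
  case One
  then show ?case by (intro exI[of _ One]) (simp add: term_equiv_def)
next
  case (Var i)
  then show ?case by (intro exI[of _ "Var i"]) (simp add: term_equiv_def)
next
  case (Neg a)
  then obtain u where "pure_term u \<and> term_in n u \<and> (\<forall>i. depth u i \<le> depth a i) \<and>
    term_equiv TA n a u \<and> term_equiv TB n a u" by auto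
  then show ?case by (intro exI[of _ "Neg u"]) (auto intro: term_equiv_cong)
next
  case (Add a b)
  then obtain u v where "pure_term u \<and> term_in n u \<and> (\<forall>i. depth u i \<le> depth a i) \<and>
      term_equiv TA n a u \<and> term_equiv TB n a u"
    "pure_term v \<and> term_in n v \<and> (\<forall>i. depth v i \<le> depth b i) \<and>
      term_equiv TA n b v \<and> term_equiv TB n b v" by auto
  then show ?case by (intro exI[of _ "Add u v"]) (auto intro: term_equiv_cong max.coboundedI1 max.coboundedI2)
next
  case (Mul a b)
  then obtain u v where "pure_term u \<and> term_in n u \<and> (\<forall>i. depth u i \<le> depth a i) \<and>
      term_equiv TA n a u \<and> term_equiv TB n a u"
    "pure_term v \<and> term_in n v \<and> (\<forall>i. depth v i \<le> depth b i) \<and>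
      term_equiv TA n b v \<and> term_equiv TB n b v" by auto
  then show ?case by (intro exI[of _ "Mul u v"]) (auto intro: term_equiv_cong max.coboundedI1 max.coboundedI2)
next
  case (Lam k a)
  then obtain u where u: "pure_term u \<and> term_in n u \<and> (\<forall>i. depth u i \<le> depth a i) \<and>
    term_equiv TA n a u \<and> term_equiv TB n a u" by auto
  let ?u = "if even k then Sig k (Neg u) else Neg (Sig k (Neg u))"
  have "term_equiv TA n (Lam k a) ?u" "term_equiv TB n (Lam k a) ?u"
    using u term_equiv_trans[OF term_equiv_cong(3) term_equiv_Lam] by blast+
  then show ?case using u Lam.prems by (intro exI[of _ ?u]) auto
next
  case (Sig k a)
  then obtain u where "pure_term u \<and> term_in n u \<and> (\<forall>i. depth u i \<le> depth a i) \<and>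
    term_equiv TA n a u \<and> term_equiv TB n a u" by auto
  then show ?case using Sig.prems by (intro exI[of _ "Sig k u"]) (auto intro: term_equiv_cong)
next
  case (Psi k a)
  then obtain u where u: "pure_term u \<and> term_in n u \<and> (\<forall>i. depth u i \<le> depth a i) \<and>
    term_equiv TA n a u \<and> term_equiv TB n a u" by auto
  have k: "k \<ge> 1" using Psi.prems by simp
  \<comment> \<open>The Newton polynomial is unfolded over \<open>u\<close> rather than
    \<open>a\<close>, since a pure result needs a pure argument.\<close>
  obtain v where v: "pure_term v" "term_in n v" "\<forall>i. depth v i \<le> k * depth u i"
      "poly_equiv TA n u (newton_poly k) v" "poly_equiv TB n u (newton_poly k) v"
    using zpoly_as_term[OF _ _ newton_poly[OF k], of u n TA TB] u by blast
  have "term_equiv TA n (Psi k a) v" "term_equiv TB n (Psi k a) v"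
    using u v k term_equiv_trans[OF term_equiv_cong(4) term_equiv_Psi] by blast+
  moreover have "depth v i \<le> depth (Psi k a) i" for i
    using v(3) u by (metis depth.simps(9) le_trans mult_le_mono2)
  ultimately show ?case using v by blast
qed

text \<open>Represents \<sigma>^k of the term for all \<open>k\<close> at once, because \<sigma>^k
  of a sum, product or composite involves further \<sigma>-operations of the subterms; the term
  itself is the case \<open>k = 1\<close>. Results are claimed for pure terms only, so the zeros for
  \<open>Lam\<close> and \<open>Psi\<close> are placeholders.\<close>

fun sig_poly :: "lterm \<Rightarrow> nat \<Rightarrow> (nat \<times> nat) zpoly" where
  "sig_poly Zero k = (if k = 0 then 1 else 0)"
| "sig_poly One k = (if k \<le> 1 then 1 else 0)"
| "sig_poly (Var i) k = (if k = 0 then 1 else zvar (i, k))"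
| "sig_poly (Neg a) k = zsubst (sig_poly a) (inverse_poly k)"
| "sig_poly (Add a b) k = (\<Sum>i\<in>{0..k}. sig_poly a i * sig_poly b (k - i))"
| "sig_poly (Mul a b) k = (if k = 0 then 1 else zsubst (case_sum (sig_poly a) (sig_poly b)) (prod_poly k))"
| "sig_poly (Sig m a) k = (if k = 0 then 1 else zsubst (sig_poly a) (comp_poly k m))"
| "sig_poly (Lam m a) k = 0"
| "sig_poly (Psi m a) k = 0"

lemma depth_polys_mono: "(\<And>i. i \<in> {1..n} \<Longrightarrow> d i \<le> e i) \<Longrightarrow> depth_polys n d \<subseteq> depth_polys n e"
  unfolding depth_polys_def by (intro zpolys_in_mono) force

text \<open>Depth mirrors the variable bounds of the universal polynomials:
  \<open>inverse_poly k\<close> and \<open>prod_poly k\<close> stop at index \<open>k\<close>, and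
  \<open>comp_poly k m\<close> at \<open>k * m\<close>.\<close>

lemma sig_poly_in: "pure_term u \<Longrightarrow> term_in n u \<Longrightarrow> sig_poly u k \<in> depth_polys n (\<lambda>i. k * depth u i)"
proof (induction u arbitrary: k)
  case (Neg a)
  have "sig_poly a j \<in> depth_polys n (\<lambda>i. k * depth a i)" if "j \<in> {1..k}" for j
    using Neg that depth_polys_mono[of n "\<lambda>i. j * depth a i" "\<lambda>i. k * depth a i"] by auto
  then show ?case
    by (auto simp: depth_polys_def intro!: zsubst_in_zpolys_in[OF inverse_poly_in])
next
  case (Add a b)
  have "sig_poly a j \<in> depth_polys n (\<lambda>i. k * depth (Add a b) i)"
    "sig_poly b j \<in> depth_polys n (\<lambda>i. k * depth (Add a b) i)" if "j \<le> k" for j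
    using Add that depth_polys_mono[of n "\<lambda>i. j * depth a i" "\<lambda>i. k * depth (Add a b) i"]
      depth_polys_mono[of n "\<lambda>i. j * depth b i" "\<lambda>i. k * depth (Add a b) i"]
    by (auto simp: mult_le_mono)
  then show ?case
    by (auto simp: depth_polys_def intro!: zpolys_in_sum zpolys_in_mult)
next
  case (Mul a b)
  have "sig_poly a j \<in> depth_polys n (\<lambda>i. k * depth (Mul a b) i)"
    "sig_poly b j \<in> depth_polys n (\<lambda>i. k * depth (Mul a b) i)" if "j \<le> k" for j
    using Mul that depth_polys_mono[of n "\<lambda>i. j * depth a i" "\<lambda>i. k * depth (Mul a b) i"]
      depth_polys_mono[of n "\<lambda>i. j * depth b i" "\<lambda>i. k * depth (Mul a b) i"]
    by (auto simp: mult_le_mono)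
  then show ?case
    by (auto simp: depth_polys_def intro!: zsubst_in_zpolys_in[OF prod_poly(1)])
next
  case (Sig m a)
  have "sig_poly a j \<in> depth_polys n (\<lambda>i. k * (m * depth a i))" if "j \<in> {1..k * m}" for j
    using Sig that depth_polys_mono[of n "\<lambda>i. j * depth a i" "\<lambda>i. k * (m * depth a i)"]
    by (auto simp flip: mult.assoc)
  then show ?case
    by (auto simp: depth_polys_def intro!: zsubst_in_zpolys_in[OF comp_poly(1)])
qed (auto simp: depth_polys_def intro: zpolys_in_zvar)

context T_model
begin

lemma zeval_power: "(\<And>v. f v \<in> carrier R) \<Longrightarrow> zeval R f (p ^ k) = zeval R f p [^] k"
  by (induction k) (auto simp: zeval_mult m_comm)

lemma interp_sig_poly:
  assumes r: "\<forall>i\<in>{1..n}. r i \<in> carrier R"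
  shows "pure_term u \<Longrightarrow> term_in n u \<Longrightarrow>
    s k (interp R l s \<psi> r u) = zeval R (\<lambda>(i, j). s j (r i)) (sig_poly u k)"
proof -
  \<comment> \<open>\<open>r\<close> is unconstrained outside the indices 1 to \<open>n\<close>; the
    default zero makes the assignment total in the carrier, and \<open>zeval_cong\<close> removes it
    at the end.\<close>
  define g where "g = (\<lambda>(i, j). if i \<in> {1..n} then s j (r i) else \<zero>)"
  have g [simp]: "g v \<in> carrier R" for v
    using r by (auto simp: g_def split: prod.split)
  have "s k (interp R l s \<psi> r u) = zeval R g (sig_poly u k)" if "pure_term u" "term_in n u"
    using that
  proof (induction u arbitrary: k)
    case Zero
    then show ?case by (simp add: S.op_zero delta_def)
  next
    case One
    consider "k = 0" | "k = 1" | "k \<ge> 2" by linarith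
    then show ?case
      by cases (auto simp: s_one S.op_1[simplified])
  next
    case (Var i)
    then have "g (i, k) = s k (r i)" by (simp add: g_def)
    then show ?case using Var r by auto
  next
    case (Neg a)
    then show ?case
      using interp_closed[OF r, of a] by (simp add: S.op_uminus zeval_zsubst)
  next
    case (Add a b)
    then have "s i (interp R l s \<psi> r a) = zeval R g (sig_poly a i)"
      "s i (interp R l s \<psi> r b) = zeval R g (sig_poly b i)" for i
      by simp_all
    with Add.prems show ?case
      using interp_closed[OF r, of a] interp_closed[OF r, of b]
      by (simp add: S.op_add convol_def zeval_sum zeval_mult)
  next
    case (Mul a b)
    have *: "(\<lambda>v. zeval R g (case v of Inl j \<Rightarrow> sig_poly a j | Inr j \<Rightarrow> sig_poly b j)) =
        case_sum (\<lambda>i. s i (interp R l s \<psi> r a)) (\<lambda>i. s i (interp R l s \<psi> r b))"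
      using Mul by (auto split: sum.split)
    show ?case
      using interp_closed[OF r, of a] interp_closed[OF r, of b] Mul.prems
      by (simp add: s_mult zeval_zsubst *)
  next
    case (Sig m a)
    then have "(\<lambda>j. zeval R g (sig_poly a j)) = (\<lambda>j. s j (interp R l s \<psi> r a))"
      by auto
    with Sig.prems show ?case
      using interp_closed[OF r, of a] by (simp add: s_comp zeval_zsubst)
  qed auto
  also have "zeval R g (sig_poly u k) = zeval R (\<lambda>(i, j). s j (r i)) (sig_poly u k)"
    if "pure_term u" "term_in n u"
    by (rule zeval_cong[OF sig_poly_in[OF that, of k, unfolded depth_polys_def]])
      (use r in \<open>auto simp: g_def\<close>)
  finally show "pure_term u \<Longrightarrow> term_in n u \<Longrightarrow>
    s k (interp R l s \<psi> r u) = zeval R (\<lambda>(i, j). s j (r i)) (sig_poly u k)" by simp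
qed

end

text \<open>The coefficient of index \<open>j\<close> in the inverse of the \<lambda>-series of
  \<open>x_i\<close> at -t. Only \<lambda>-operations of index at most \<open>j\<close> occur, so
  substituting it respects the depth.\<close>

definition sigma_in_lambda :: "nat \<times> nat \<Rightarrow> (nat \<times> nat) zpoly" where
  "sigma_in_lambda = (\<lambda>(i, j). zsubst (\<lambda>m. (-1) ^ m * zvar (i, m)) (inverse_poly j))"

lemma sigma_in_lambda_in:
  assumes "P \<in> depth_polys n d"
  shows "zsubst sigma_in_lambda P \<in> depth_polys n d"
  unfolding depth_polys_def
proof (rule zsubst_in_zpolys_in[OF assms[unfolded depth_polys_def]], clarify)
  fix i j assume "i \<in> {1..n}" "j \<in> {1..d i}"
  then have "(-1) ^ m * zvar (i, m) \<in> zpolys_in (SIGMA i:{1..n}. {1..d i})" if "m \<in> {1..j}" for m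
    using that by (intro zpolys_in_mult zpolys_in_power zpolys_in_uminus zpolys_in_zvar) auto
  then show "sigma_in_lambda (i, j) \<in> zpolys_in (SIGMA i:{1..n}. {1..d i})"
    unfolding sigma_in_lambda_def prod.case by (rule zsubst_in_zpolys_in[OF inverse_poly_in])
qed

lemma (in T_model) zeval_sigma_in_lambda:
  assumes r: "\<forall>i\<in>{1..n}. r i \<in> carrier R" and P: "P \<in> depth_polys n d"
  shows "zeval R (\<lambda>(i, j). l j (r i)) (zsubst sigma_in_lambda P) = zeval R (\<lambda>(i, j). s j (r i)) P"
proof -
  define g where "g = (\<lambda>(i, j). if i \<in> {1..n} then l j (r i) else \<zero>)"
  have g [simp]: "g v \<in> carrier R" for v
    using r by (auto simp: g_def split: prod.split)
  have "zeval R (\<lambda>(i, j). l j (r i)) (zsubst sigma_in_lambda P) = zeval R g (zsubst sigma_in_lambda P)"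
    by (rule zeval_cong[OF sigma_in_lambda_in[OF P, unfolded depth_polys_def]])
      (use r in \<open>auto simp: g_def\<close>)
  also have "\<dots> = zeval R (\<lambda>v. zeval R g (sigma_in_lambda v)) P"
    by (simp add: zeval_zsubst)
  also have "\<dots> = zeval R (\<lambda>(i, j). s j (r i)) P"
  proof (rule zeval_cong[OF P[unfolded depth_polys_def]])
    fix v assume v: "v \<in> (SIGMA i:{1..n}. {1..d i})"
    then obtain i j where ij: "v = (i, j)" "i \<in> {1..n}" by auto
    then have ri: "r i \<in> carrier R" using r by auto
    then show "(case v of (i, j) \<Rightarrow> s j (r i)) \<in> carrier R" by (simp add: ij)
    have "g (i, m) = l m (r i)" for m
      using ij by (simp add: g_def)
    then have "zeval R g ((-1) ^ m * zvar (i, m)) = alternating R (\<lambda>m. l m (r i)) m" for m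
      by (simp add: zeval_mult zeval_power zeval_uminus alternating_def)
    then show "zeval R g (sigma_in_lambda v) = (case v of (i, j) \<Rightarrow> s j (r i))"
      using ri by (simp add: ij sigma_in_lambda_def zeval_zsubst s_eq)
  qed
  finally show ?thesis .
qed

lemma lambda_represents_of_sigma:
  assumes "sigma_represents TA n \<phi> P" "P \<in> depth_polys n d"
  shows "lambda_represents TA n \<phi> (zsubst sigma_in_lambda P)"
  unfolding lambda_represents_def
proof safe
  fix R :: "'a ring" and l s \<psi> r
  assume mr: "model_of_T R l s \<psi>" "\<forall>i\<in>{1..n}. r i \<in> carrier R"
  then interpret T_model R l s \<psi> by unfold_locales
  show "interp R l s \<psi> r \<phi> = zeval R (\<lambda>(i, j). l j (r i)) (zsubst sigma_in_lambda P)"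
    using assms mr by (simp add: sigma_represents_def zeval_sigma_in_lambda)
qed

lemma sigma_represents_sig_poly:
  assumes "term_equiv TA n \<phi> u" "pure_term u" "term_in n u"
  shows "sigma_represents TA n \<phi> (sig_poly u 1)"
  unfolding sigma_represents_def
proof safe
  fix R :: "'a ring" and l s \<psi> r
  assume mr: "model_of_T R l s \<psi>" "\<forall>i\<in>{1..n}. r i \<in> carrier R"
  then interpret T_model R l s \<psi> by unfold_locales
  show "interp R l s \<psi> r \<phi> = zeval R (\<lambda>(i, j). s j (r i)) (sig_poly u 1)"
    using interp_sig_poly[OF mr(2) assms(2,3), of 1] interp_closed[OF mr(2) assms(3)] assms(1) mr
    by (simp add: term_equiv_def S.op_1[simplified])
qed

lemma sigma_represents_exists:
  fixes TA :: "'a itself" and TB :: "'b itself"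
  assumes "term_in n \<phi>" "\<forall>i\<in>{1..n}. depth \<phi> i = d i"
  shows "\<exists>P\<in>depth_polys n d. sigma_represents TA n \<phi> P \<and> sigma_represents TB n \<phi> P"
proof -
  obtain u where u: "pure_term u" "term_in n u" "\<forall>i. depth u i \<le> depth \<phi> i"
    "term_equiv TA n \<phi> u" "term_equiv TB n \<phi> u"
    using term_equiv_pure[OF assms(1), of TA TB] by blast
  have "sig_poly u 1 \<in> depth_polys n d"
    by (rule subsetD[OF depth_polys_mono sig_poly_in[OF u(1,2), of 1]]) (use u(3) assms(2) in \<open>metis mult_1\<close>)
  then show ?thesis
    using sigma_represents_sig_poly[OF u(4,1,2)] sigma_represents_sig_poly[OF u(5,1,2)] by blast
qed

section \<open>Newton's recursion over the complex numbers\<close>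

text \<open>The elementary symmetric functions belonging to prescribed power sums \<open>a 1, a 2, \<dots>\<close>.\<close>

fun newton_elsym :: "(nat \<Rightarrow> complex) \<Rightarrow> nat \<Rightarrow> complex" where
  "newton_elsym a 0 = 1"
| "newton_elsym a (Suc n) = (\<Sum>i\<le>n. (-1) ^ i * newton_elsym a (n - i) * a (Suc i)) / of_nat (Suc n)"

text \<open>The recursion is assumed only below \<open>N\<close> because finitely many numbers will
  match given power sums only up to a bounded degree.\<close>

lemma newton_elsym_unique:
  assumes "f 0 = 1" and "\<And>n. n < N \<Longrightarrow> of_nat (Suc n) * f (Suc n) = (\<Sum>i\<le>n. (-1) ^ i * f (n - i) * a (Suc i))"
  shows "n \<le> N \<Longrightarrow> f n = newton_elsym a n"
proof (induction n rule: less_induct)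
  case (less n)
  show ?case
  proof (cases n)
    case (Suc m)
    have "of_nat (Suc m) * f (Suc m) = (\<Sum>i\<le>m. (-1) ^ i * newton_elsym a (m - i) * a (Suc i))"
      using assms(2)[of m] less Suc by (auto intro!: sum.cong)
    then show ?thesis
      by (simp add: Suc field_simps del: of_nat_Suc)
  qed (use assms in simp)
qed

text \<open>Newton's recursion says that the generating series solves the linear differential
  equation \<open>fps_deriv (F a) = D a * F a\<close> with constant term 1. Since \<open>D\<close>
  is additive, the product rule gives \<open>F a * F b\<close> the equation belonging to the sum,
  and its solution is unique.\<close>

lemma newton_elsym_add:
  "newton_elsym (\<lambda>k. a k + b k) n = (\<Sum>i\<in>{0..n}. newton_elsym a i * newton_elsym b (n - i))"
proof -
  define F where "F a = Abs_fps (newton_elsym a)" for a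
  define D where "D a = Abs_fps (\<lambda>i. (-1) ^ i * a (Suc i) :: complex)" for a
  have deriv: "fps_deriv (F a) = D a * F a" for a
  proof (rule fps_ext)
    fix n
    have "newton_elsym a (Suc n) * of_nat (Suc n) = (\<Sum>i\<le>n. (-1) ^ i * newton_elsym a (n - i) * a (Suc i))"
      by (simp del: of_nat_Suc)
    then show "fps_nth (fps_deriv (F a)) n = fps_nth (D a * F a) n"
      unfolding fps_mult_nth F_def D_def fps_deriv_nth fps_nth_Abs_fps atLeast0AtMost
      by (simp add: mult_ac del: newton_elsym.simps)
  qed
  define G where "G = F a * F b"
  have "fps_deriv G = D (\<lambda>k. a k + b k) * G"
  proof -
    have "D (\<lambda>k. a k + b k) = D a + D b"
      by (rule fps_ext) (simp add: D_def algebra_simps)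
    then show ?thesis by (simp add: G_def deriv algebra_simps)
  qed
  from arg_cong[OF this, of fps_nth]
  have "of_nat (Suc n) * fps_nth G (Suc n) =
      (\<Sum>i\<le>n. (-1) ^ i * fps_nth G (n - i) * (a (Suc i) + b (Suc i)))" for n
    unfolding fun_eq_iff fps_deriv_nth fps_mult_nth D_def fps_nth_Abs_fps atLeast0AtMost
    by (simp add: mult_ac)
  then have "fps_nth G n = newton_elsym (\<lambda>k. a k + b k) n"
    by (intro newton_elsym_unique[where N = n]) (auto simp: G_def F_def)
  then show ?thesis
    by (simp add: fps_mult_nth F_def G_def)
qed

lemma newton_elsym_zero: "newton_elsym (\<lambda>_. 0) n = (if n = 0 then 1 else 0)"
  by (cases n) auto

lemma newton_elsym_eq:
  assumes "finite I" "\<And>k. 1 \<le> k \<Longrightarrow> k \<le> N \<Longrightarrow> a k = (\<Sum>i\<in>I. x i ^ k)" "n \<le> N"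
  shows "newton_elsym a n = elsym x I n"
proof (rule newton_elsym_unique[symmetric, where N = N])
  show "of_nat (Suc n) * elsym x I (Suc n) = (\<Sum>i\<le>n. (-1) ^ i * elsym x I (n - i) * a (Suc i))"
    if "n < N" for n
    using assms(2) that unfolding newton_identity[OF assms(1)] by (auto intro!: sum.cong)
qed (use assms in auto)

text \<open>At step \<open>k\<close> the recursion contains \<open>a k\<close> with coefficient 1 or
  -1 and otherwise only earlier power sums.\<close>

lemma newton_elsym_inj:
  assumes "\<And>k. k \<le> N \<Longrightarrow> newton_elsym a k = newton_elsym b k"
  shows "1 \<le> k \<Longrightarrow> k \<le> N \<Longrightarrow> a k = b k"
proof (induction k rule: less_induct)
  case (less k)
  then obtain m where m: "k = Suc m" by (cases k) auto
  have eq: "of_nat k * newton_elsym c k = (\<Sum>i<m. (-1) ^ i * newton_elsym c (m - i) * c (Suc i)) + (-1) ^ m * c k" for c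
    by (simp add: m lessThan_Suc_atMost[symmetric] del: of_nat_Suc)
  have "(\<Sum>i<m. (-1) ^ i * newton_elsym a (m - i) * a (Suc i)) =
      (\<Sum>i<m. (-1) ^ i * newton_elsym b (m - i) * b (Suc i))"
    by (rule sum.cong) (use less m assms in auto)
  then show ?case
    using eq[of a] eq[of b] assms[of k] less.prems by simp
qed

lemma newton_elsym_surj: "\<exists>x. \<forall>k\<in>{1..N}. newton_elsym (\<lambda>k. \<Sum>i\<in>{1..N}. x i ^ k) k = c k"
proof -
  obtain x where x: "\<forall>k\<in>{1..N}. esym x N k = c k"
    using esym_surj by blast
  have "newton_elsym (\<lambda>k. \<Sum>i\<in>{1..N}. x i ^ k) k = esym x N k" for k
    unfolding esym_eq_elsym by (rule newton_elsym_eq[where N = k]) auto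
  with x show ?thesis by (intro exI[of _ x]) auto
qed

text \<open>The elementary symmetric functions are matched first, where algebraic closedness
  applies; injectivity of the recursion carries the match back to the power sums.\<close>

lemma power_sums_surj: "\<exists>x. (\<forall>k. 1 \<le> k \<longrightarrow> k \<le> N \<longrightarrow> a k = (\<Sum>i\<in>{1..N}. x i ^ k :: complex)) \<and>
    (\<forall>k\<le>N. newton_elsym a k = esym x N k)"
proof -
  obtain x where x: "\<forall>k\<in>{1..N}. newton_elsym (\<lambda>k. \<Sum>i\<in>{1..N}. x i ^ k) k = newton_elsym a k"
    using newton_elsym_surj by blast
  have "newton_elsym a k = newton_elsym (\<lambda>k. \<Sum>i\<in>{1..N}. x i ^ k) k" if "k \<le> N" for k
    using x that by (cases "k = 0") auto
  then have *: "a k = (\<Sum>i\<in>{1..N}. x i ^ k)" if "1 \<le> k" "k \<le> N" for k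
    by (rule newton_elsym_inj[OF _ that])
  have "newton_elsym a k = esym x N k" if "k \<le> N" for k
    unfolding esym_eq_elsym by (rule newton_elsym_eq[where N = N]) (use * that in auto)
  with * show ?thesis by blast
qed

text \<open>The products \<open>x i * y j\<close> have as power sums the products of the power sums
  of \<open>x\<close> and of \<open>y\<close>. Matching up to degree \<open>n\<close> suffices for
  the value at \<open>n\<close>.\<close>

lemma newton_elsym_mult:
  "newton_elsym (\<lambda>k. a k * b k) n = zsubst (case_sum (newton_elsym a) (newton_elsym b)) (prod_poly n)"
proof -
  obtain x where x: "\<forall>k. 1 \<le> k \<longrightarrow> k \<le> n \<longrightarrow> a k = (\<Sum>i\<in>{1..n}. x i ^ k)"
    "\<forall>k\<le>n. newton_elsym a k = esym x n k"
    using power_sums_surj[where a = a and N = n] by blast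
  obtain y where y: "\<forall>k. 1 \<le> k \<longrightarrow> k \<le> n \<longrightarrow> b k = (\<Sum>i\<in>{1..n}. y i ^ k)"
    "\<forall>k\<le>n. newton_elsym b k = esym y n k"
    using power_sums_surj[where a = b and N = n] by blast
  have "zsubst (case_sum (newton_elsym a) (newton_elsym b)) (prod_poly n) =
      zsubst (\<lambda>v. zsubst (case_sum x y)
        (case_sum (esym (\<lambda>i. zvar (Inl i)) n) (esym (\<lambda>j. zvar (Inr j)) n) v)) (prod_poly n)"
    by (rule zsubst_cong[OF prod_poly(1)]) (use x(2) y(2) in \<open>auto simp: esym_eq_elsym\<close>)
  also have "\<dots> = elsym (\<lambda>(i, j). x i * y j) ({1..n} \<times> {1..n}) n"
    unfolding zsubst_zsubst[symmetric] prod_poly(2) by (simp add: case_prod_unfold)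
  also have "\<dots> = newton_elsym (\<lambda>k. a k * b k) n"
    by (rule newton_elsym_eq[symmetric, where N = n])
      (use x(1) y(1) in \<open>auto simp: sum_product sum.cartesian_product case_prod_unfold power_mult_distrib\<close>)
  finally show ?thesis ..
qed

text \<open>The sequence \<open>a (k * j)\<close> in \<open>j\<close> consists of the power sums of
  the \<open>x i ^ k\<close>. Its \<open>m\<close>-th elementary symmetric function is therefore the
  \<open>k\<close>-th power sum of the products over \<open>m\<close>-subsets. The largest index met
  is \<open>n * m\<close>, hence the choice of \<open>?N\<close>.\<close>

lemma newton_elsym_comp:
  assumes "n \<ge> 1" "m \<ge> 1"
  shows "newton_elsym (\<lambda>k. newton_elsym (\<lambda>j. a (k * j)) m) n = zsubst (newton_elsym a) (comp_poly n m)"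
proof -
  let ?N = "n * m" and ?S = "{J. J \<subseteq> {1..n * m} \<and> card J = m}"
  obtain x where x: "\<forall>k. 1 \<le> k \<longrightarrow> k \<le> ?N \<longrightarrow> a k = (\<Sum>i\<in>{1..?N}. x i ^ k)"
    "\<forall>k\<le>?N. newton_elsym a k = esym x ?N k"
    using power_sums_surj[where a = a and N = ?N] by blast
  have "zsubst (newton_elsym a) (comp_poly n m) =
      zsubst (\<lambda>v. zsubst x (esym zvar ?N v)) (comp_poly n m)"
    by (rule zsubst_cong[OF comp_poly(1)]) (use x(2) in \<open>auto simp: esym_eq_elsym\<close>)
  also have "\<dots> = elsym (\<lambda>J. \<Prod>k\<in>J. x k) ?S n"
    unfolding zsubst_zsubst[symmetric] comp_poly(2) by simp
  also have "\<dots> = newton_elsym (\<lambda>k. newton_elsym (\<lambda>j. a (k * j)) m) n"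
  proof (rule newton_elsym_eq[symmetric, where N = n])
    fix k assume k: "1 \<le> k" "k \<le> n"
    have "newton_elsym (\<lambda>j. a (k * j)) m = elsym (\<lambda>i. x i ^ k) {1..?N} m"
    proof (rule newton_elsym_eq[where N = m])
      fix j assume "1 \<le> j" "j \<le> m"
      then have "1 \<le> k * j" "k * j \<le> ?N"
        using k by (auto simp: mult_le_mono)
      then show "a (k * j) = (\<Sum>i\<in>{1..?N}. (x i ^ k) ^ j)"
        using x(1) by (simp flip: power_mult)
    qed auto
    then show "newton_elsym (\<lambda>j. a (k * j)) m = (\<Sum>J\<in>?S. (\<Prod>k\<in>J. x k) ^ k)"
      by (simp add: elsym_def prod_power_distrib)
  qed auto
  finally show ?thesis ..
qed

section \<open>A countable model with algebraically independent operations\<close>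

text \<open>\<open>p i k\<close> is the value at \<open>p\<close> of \<psi>_k applied to the
  generator x_i, for k at least 1; a point chooses all of these independently.\<close>

type_synonym point = "nat \<Rightarrow> nat \<Rightarrow> complex"

definition frob :: "nat \<Rightarrow> point \<Rightarrow> point" where
  "frob k p = (\<lambda>i j. p i (k * j))"

definition fsig :: "nat \<Rightarrow> (point \<Rightarrow> complex) \<Rightarrow> point \<Rightarrow> complex" where
  "fsig n f p = newton_elsym (\<lambda>k. f (frob k p)) n"

text \<open>The form that \<open>l_eq\<close> forces on any \<lambda>-structure whose opposite is
  the \<sigma>-structure.\<close>

definition flam :: "nat \<Rightarrow> (point \<Rightarrow> complex) \<Rightarrow> point \<Rightarrow> complex" where
  "flam n f p = (-1) ^ n * fsig n (\<lambda>q. - f q) p"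

lemma frob_1: "frob (Suc 0) p = p"
  by (simp add: frob_def)

text \<open>Successive actions multiply their indices, which is the rule \<psi>_k \<psi>_j =
  \<psi>_kj; it brings the composition axiom into the shape of
  \<open>newton_elsym_comp\<close>.\<close>

lemma fsig_frob: "fsig m f (frob k p) = newton_elsym (\<lambda>j. f (frob (k * j) p)) m"
  by (simp add: fsig_def frob_def mult.assoc)

lemma fsig_0: "fsig 0 f = (\<lambda>_. 1)" and fsig_1: "fsig (Suc 0) f = f"
  by (auto simp: fsig_def frob_1)

instance lterm :: countable
  by countable_datatype

text \<open>Only the range of \<open>feval\<close> matters, so the clause for \<open>Psi\<close> is arbitrary: Adams operations are
  not part of the closure conditions on a carrier.\<close>

primrec feval :: "lterm \<Rightarrow> point \<Rightarrow> complex" where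
  "feval Zero = (\<lambda>_. 0)"
| "feval One = (\<lambda>_. 1)"
| "feval (Var i) = (\<lambda>p. p i (Suc 0))"
| "feval (Neg a) = (\<lambda>p. - feval a p)"
| "feval (Add a b) = (\<lambda>p. feval a p + feval b p)"
| "feval (Mul a b) = (\<lambda>p. feval a p * feval b p)"
| "feval (Lam k a) = flam k (feval a)"
| "feval (Sig k a) = fsig k (feval a)"
| "feval (Psi k a) = feval a"

section \<open>Transport of the function model to the natural numbers\<close>

definition enc :: "(point \<Rightarrow> complex) \<Rightarrow> nat" where
  "enc = to_nat_on (range feval)"

definition dec :: "nat \<Rightarrow> point \<Rightarrow> complex" where
  "dec = from_nat_into (range feval)"

text \<open>There are only countably many terms, so \<open>range feval\<close> is countable and the
  coding is faithful on it.\<close>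

lemma dec_enc: "f \<in> range feval \<Longrightarrow> dec (enc f) = f"
  by (simp add: dec_def enc_def)

lemma range_feval:
  shows "(\<lambda>_. 0) \<in> range feval" "(\<lambda>_. 1) \<in> range feval" "(\<lambda>p. p i (Suc 0)) \<in> range feval"
    and "f \<in> range feval \<Longrightarrow> (\<lambda>p. - f p) \<in> range feval"
    and "f \<in> range feval \<Longrightarrow> g \<in> range feval \<Longrightarrow> (\<lambda>p. f p + g p) \<in> range feval"
    and "f \<in> range feval \<Longrightarrow> g \<in> range feval \<Longrightarrow> (\<lambda>p. f p * g p) \<in> range feval"
    and "f \<in> range feval \<Longrightarrow> flam k f \<in> range feval"
    and "f \<in> range feval \<Longrightarrow> fsig k f \<in> range feval"
proof -
  have eq: "feval t \<in> range feval" for t by simp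
  show "(\<lambda>_. 0) \<in> range feval" "(\<lambda>_. 1) \<in> range feval" "(\<lambda>p. p i (Suc 0)) \<in> range feval"
    using eq[of Zero] eq[of One] eq[of "Var i"] by simp_all
  assume "f \<in> range feval"
  then obtain a where a: "f = feval a" by auto
  show "(\<lambda>p. - f p) \<in> range feval" "flam k f \<in> range feval" "fsig k f \<in> range feval"
    using eq[of "Neg a"] eq[of "Lam k a"] eq[of "Sig k a"] by (simp_all add: a)
  assume "g \<in> range feval"
  then obtain b where b: "g = feval b" by auto
  show "(\<lambda>p. f p + g p) \<in> range feval" "(\<lambda>p. f p * g p) \<in> range feval"
    using eq[of "Add a b"] eq[of "Mul a b"] by (simp_all add: a b)
qed

definition mring :: "nat ring" where
  "mring = \<lparr>carrier = enc ` range feval,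
     monoid.mult = (\<lambda>x y. enc (\<lambda>p. dec x p * dec y p)), one = enc (\<lambda>_. 1),
     zero = enc (\<lambda>_. 0), add = (\<lambda>x y. enc (\<lambda>p. dec x p + dec y p))\<rparr>"

definition msig :: "nat \<Rightarrow> nat \<Rightarrow> nat" where "msig n x = enc (fsig n (dec x))"

definition mlam :: "nat \<Rightarrow> nat \<Rightarrow> nat" where "mlam n x = enc (flam n (dec x))"

definition mvar :: "nat \<Rightarrow> nat" where "mvar i = enc (\<lambda>p. p i (Suc 0))"

lemma dec_in: "x \<in> carrier mring \<Longrightarrow> dec x \<in> range feval"
  by (auto simp: mring_def dec_enc)

lemma enc_in: "f \<in> range feval \<Longrightarrow> enc f \<in> carrier mring"
  by (simp add: mring_def)

lemma enc_dec: "x \<in> carrier mring \<Longrightarrow> enc (dec x) = x"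
  by (auto simp: mring_def dec_enc)

text \<open>Reduces each axiom of the model to an identity of complex numbers at a single
  point.\<close>

lemma mring_eqI: "x \<in> carrier mring \<Longrightarrow> y \<in> carrier mring \<Longrightarrow> (\<And>p. dec x p = dec y p) \<Longrightarrow> x = y"
  by (metis enc_dec ext)

lemma mring_closed:
  "\<one>\<^bsub>mring\<^esub> \<in> carrier mring" "\<zero>\<^bsub>mring\<^esub> \<in> carrier mring" "mvar i \<in> carrier mring"
  "x \<in> carrier mring \<Longrightarrow> y \<in> carrier mring \<Longrightarrow> x \<oplus>\<^bsub>mring\<^esub> y \<in> carrier mring"
  "x \<in> carrier mring \<Longrightarrow> y \<in> carrier mring \<Longrightarrow> x \<otimes>\<^bsub>mring\<^esub> y \<in> carrier mring"
  "x \<in> carrier mring \<Longrightarrow> msig n x \<in> carrier mring" "x \<in> carrier mring \<Longrightarrow> mlam n x \<in> carrier mring"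
  by (auto simp: mvar_def msig_def mlam_def dec_in intro!: enc_in range_feval)
    (auto simp: mring_def dec_in intro!: imageI range_feval dec_in[unfolded mring_def, simplified])

lemma dec_simps:
  "dec \<one>\<^bsub>mring\<^esub> p = 1" "dec \<zero>\<^bsub>mring\<^esub> p = 0" "dec (mvar i) p = p i (Suc 0)"
  "x \<in> carrier mring \<Longrightarrow> y \<in> carrier mring \<Longrightarrow> dec (x \<oplus>\<^bsub>mring\<^esub> y) p = dec x p + dec y p"
  "x \<in> carrier mring \<Longrightarrow> y \<in> carrier mring \<Longrightarrow> dec (x \<otimes>\<^bsub>mring\<^esub> y) p = dec x p * dec y p"
  "x \<in> carrier mring \<Longrightarrow> dec (msig n x) p = fsig n (dec x) p"
  "x \<in> carrier mring \<Longrightarrow> dec (mlam n x) p = flam n (dec x) p"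
  by (auto simp: mring_def mvar_def msig_def mlam_def dec_enc range_feval)

lemma cring_mring: "cring mring"
proof (rule cringI)
  show "abelian_group mring"
  proof (rule abelian_groupI)
    fix x assume x: "x \<in> carrier mring"
    have "enc (\<lambda>p. - dec x p) \<in> carrier mring"
      using x by (intro enc_in range_feval dec_in)
    moreover have "enc (\<lambda>p. - dec x p) \<oplus>\<^bsub>mring\<^esub> x = \<zero>\<^bsub>mring\<^esub>"
      by (rule mring_eqI)
        (use x calculation in \<open>auto simp: mring_closed dec_simps dec_enc range_feval dec_in\<close>)
    ultimately show "\<exists>y\<in>carrier mring. y \<oplus>\<^bsub>mring\<^esub> x = \<zero>\<^bsub>mring\<^esub>" by blast
  qed (auto simp: mring_closed dec_simps algebra_simps intro!: mring_eqI)
  show "comm_monoid mring"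
    by (rule comm_monoidI) (auto simp: mring_closed dec_simps algebra_simps intro!: mring_eqI)
qed (auto simp: mring_closed dec_simps algebra_simps intro!: mring_eqI)

interpretation mring: cring mring
  by (rule cring_mring)

lemma dec_a_inv: "x \<in> carrier mring \<Longrightarrow> dec (\<ominus>\<^bsub>mring\<^esub> x) p = - dec x p"
  using dec_simps(4)[of x "\<ominus>\<^bsub>mring\<^esub> x" p] by (simp add: mring.r_neg dec_simps eq_neg_iff_add_eq_0 add.commute)

lemma dec_finsum:
  "finite A \<Longrightarrow> (\<And>i. i \<in> A \<Longrightarrow> f i \<in> carrier mring) \<Longrightarrow>
    dec (finsum mring f A) p = (\<Sum>i\<in>A. dec (f i) p)"
  by (induction A rule: finite_induct) (auto simp: dec_simps Pi_def)

lemma dec_zeval: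
  assumes "\<And>v. f v \<in> carrier mring"
  shows "dec (zeval mring f P) p = zsubst (\<lambda>v. dec (f v) p) P"
  by (induction P rule: zpoly_induct)
    (use assms in \<open>auto simp: dec_simps dec_a_inv mring.zeval_add mring.zeval_mult mring.zeval_uminus\<close>)

lemma dec_convol:
  assumes "\<And>i. f i \<in> carrier mring" "\<And>i. g i \<in> carrier mring"
  shows "dec (convol mring f g n) p = (\<Sum>i\<in>{0..n}. dec (f i) p * dec (g (n - i)) p)"
  using assms unfolding convol_def by (subst dec_finsum) (auto simp: dec_simps)

lemma convol_closed:
  "(\<And>i. f i \<in> carrier mring) \<Longrightarrow> (\<And>i. g i \<in> carrier mring) \<Longrightarrow> convol mring f g n \<in> carrier mring"
  unfolding convol_def by (rule mring.finsum_closed) auto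

lemma lambda_ring_msig: "lambda_ring mring msig"
  unfolding lambda_ring_def
proof (intro conjI allI ballI)
  fix n x y assume xy: "x \<in> carrier mring" "y \<in> carrier mring"
  have "msig n (x \<oplus>\<^bsub>mring\<^esub> y) = convol mring (\<lambda>i. msig i x) (\<lambda>i. msig i y) n"
    by (rule mring_eqI)
      (use xy in \<open>auto simp: dec_convol convol_closed mring_closed dec_simps fsig_def newton_elsym_add\<close>)
  then show "msig n (x \<oplus>\<^bsub>mring\<^esub> y) = (\<Oplus>\<^bsub>mring\<^esub>i\<in>{0..n}. msig i x \<otimes>\<^bsub>mring\<^esub> msig (n - i) y)"
    by (simp only: convol_def)
qed (auto simp: cring_mring mring_closed dec_simps fsig_0 fsig_1 intro!: mring_eqI)

lemma flam_add: "flam n (\<lambda>p. f p + g p) p = (\<Sum>i\<in>{0..n}. flam i f p * flam (n - i) g p)"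
proof -
  have "flam n (\<lambda>p. f p + g p) p =
      (-1) ^ n * newton_elsym (\<lambda>k. - f (frob k p) + - g (frob k p)) n"
    by (simp add: flam_def fsig_def)
  also have "\<dots> = (\<Sum>i\<in>{0..n}. (-1) ^ n * (fsig i (\<lambda>q. - f q) p * fsig (n - i) (\<lambda>q. - g q) p))"
    unfolding newton_elsym_add by (simp add: sum_distrib_left fsig_def)
  also have "\<dots> = (\<Sum>i\<in>{0..n}. flam i f p * flam (n - i) g p)"
  proof (rule sum.cong[OF refl])
    fix i assume "i \<in> {0..n}"
    then have "(-1 :: complex) ^ n = (-1) ^ i * (-1) ^ (n - i)"
      by (simp flip: power_add)
    then show "(-1) ^ n * (fsig i (\<lambda>q. - f q) p * fsig (n - i) (\<lambda>q. - g q) p) =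
        flam i f p * flam (n - i) g p"
      by (simp add: flam_def)
  qed
  finally show ?thesis .
qed

lemma lambda_ring_mlam: "lambda_ring mring mlam"
  unfolding lambda_ring_def
proof (intro conjI allI ballI)
  fix n x y assume xy: "x \<in> carrier mring" "y \<in> carrier mring"
  have "dec (x \<oplus>\<^bsub>mring\<^esub> y) = (\<lambda>p. dec x p + dec y p)"
    using xy by (auto simp: dec_simps)
  then have "mlam n (x \<oplus>\<^bsub>mring\<^esub> y) = convol mring (\<lambda>i. mlam i x) (\<lambda>i. mlam i y) n"
    by (intro mring_eqI)
      (use xy in \<open>auto simp: dec_convol convol_closed mring_closed dec_simps flam_add\<close>)
  then show "mlam n (x \<oplus>\<^bsub>mring\<^esub> y) = (\<Oplus>\<^bsub>mring\<^esub>i\<in>{0..n}. mlam i x \<otimes>\<^bsub>mring\<^esub> mlam (n - i) y)"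
    by (simp only: convol_def)
qed (auto simp: cring_mring mring_closed dec_simps flam_def fsig_0 fsig_1 intro!: mring_eqI)

text \<open>By the definition of \<open>flam\<close>, the series \<open>?a\<close> has the
  \<sigma>-operations of the negative as coefficients. At each point its product with the
  \<sigma>-series belongs to power sums that are all 0, so it is 1, and inverses are unique.\<close>

lemma msig_opposite:
  assumes x: "x \<in> carrier mring"
  shows "msig n x = opposite mring mlam n x"
proof -
  let ?a = "alternating mring (\<lambda>i. mlam i x)"
  have dec_a: "dec (?a i) p = fsig i (\<lambda>q. - dec x q) p" for i p
    using x by (auto simp: mring.alternating_eq mring_closed dec_a_inv dec_simps flam_def)
  have "convol mring ?a (\<lambda>i. msig i x) n = delta mring n" for n
  proof (rule mring_eqI)
    fix p
    have "dec (convol mring ?a (\<lambda>i. msig i x) n) p =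
        newton_elsym (\<lambda>k. - dec x (frob k p) + dec x (frob k p)) n"
      unfolding newton_elsym_add using x by (simp add: dec_convol dec_a mring_closed dec_simps fsig_def)
    then show "dec (convol mring ?a (\<lambda>i. msig i x) n) p = dec (delta mring n) p"
      by (auto simp: newton_elsym_zero delta_def dec_simps)
  qed (use x in \<open>auto simp: convol_closed mring_closed delta_def\<close>)
  moreover have "?a i \<in> carrier mring" for i
    using x by (simp add: mring_closed)
  moreover have "?a 0 = \<one>\<^bsub>mring\<^esub>"
    using lambda_ring_mlam x by (simp add: mring.alternating_eq mring_closed lambda_ring_def)
  ultimately have "msig n x = zeval mring ?a (inverse_poly n)"
    using x by (intro mring.convol_inverse_unique[where g = "\<lambda>i. msig i x"]) (auto simp: mring_closed)
  also have "\<dots> = opposite mring mlam n x"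
    using lambda_ring_mlam x by (intro mring.opposite_eq[symmetric]) (auto simp: mring_closed lambda_ring_def)
  finally show ?thesis .
qed

lemma special_msig: "special mring msig"
  unfolding special_def
proof (intro conjI allI impI ballI)
  show "lambda_ring mring msig" by (rule lambda_ring_msig)
next
  fix n :: nat assume "n \<ge> 2"
  \<comment> \<open>The constant sequence 1 consists of the power sums of the single number 1, which
    has no elementary symmetric function of degree 2 or more.\<close>
  then have "newton_elsym (\<lambda>_. 1) n = 0"
    using newton_elsym_eq[of "{()}" n "\<lambda>_. 1" "\<lambda>_. 1" n] by (simp add: elsym_eq_0)
  then show "msig n \<one>\<^bsub>mring\<^esub> = \<zero>\<^bsub>mring\<^esub>"
    by (intro mring_eqI) (auto simp: mring_closed dec_simps fsig_def)
next
  fix n :: nat and x y assume "n \<ge> 1" and xy: "x \<in> carrier mring" "y \<in> carrier mring"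
  have car: "case_sum (\<lambda>i. msig i x) (\<lambda>i. msig i y) v \<in> carrier mring" for v
    using xy by (auto simp: mring_closed split: sum.split)
  have case_eq: "(\<lambda>v. dec (case_sum (\<lambda>i. msig i x) (\<lambda>i. msig i y) v) p) =
      case_sum (newton_elsym (\<lambda>k. dec x (frob k p))) (newton_elsym (\<lambda>k. dec y (frob k p)))" for p
    using xy by (auto simp: dec_simps fsig_def split: sum.split)
  show "msig n (x \<otimes>\<^bsub>mring\<^esub> y) = zeval mring (case_sum (\<lambda>i. msig i x) (\<lambda>i. msig i y)) (prod_poly n)"
    by (rule mring_eqI)
      (use xy car in \<open>auto simp: dec_zeval case_eq mring_closed dec_simps fsig_def newton_elsym_mult\<close>)
next
  fix n m :: nat and x assume nm: "n \<ge> 1" "m \<ge> 1" and x: "x \<in> carrier mring"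
  show "msig n (msig m x) = zeval mring (\<lambda>i. msig i x) (comp_poly n m)"
  proof (rule mring_eqI)
    fix p
    have "dec (msig n (msig m x)) p = newton_elsym (\<lambda>k. newton_elsym (\<lambda>j. dec x (frob (k * j) p)) m) n"
      using x by (simp add: mring_closed dec_simps fsig_def[of n] fsig_frob)
    also have "\<dots> = zsubst (newton_elsym (\<lambda>k. dec x (frob k p))) (comp_poly n m)"
      by (rule newton_elsym_comp[OF nm])
    also have "\<dots> = dec (zeval mring (\<lambda>i. msig i x) (comp_poly n m)) p"
      using x by (simp add: dec_zeval mring_closed dec_simps fsig_def)
    finally show "dec (msig n (msig m x)) p = dec (zeval mring (\<lambda>i. msig i x) (comp_poly n m)) p" .
  qed (use x in \<open>simp_all add: mring_closed\<close>)
qed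

lemma model_mring: "model_of_T mring mlam msig (adams mring msig)"
  unfolding model_of_T_def
  using cring_mring lambda_ring_mlam special_msig msig_opposite by blast

section \<open>Algebraic independence of the operations on the generators\<close>

lemma finite_depth_vars: "finite (SIGMA i:{1..n :: nat}. {1..d i :: nat})"
  by auto

lemma sigma_represents_unique:
  assumes "P \<in> depth_polys n d" "Q \<in> depth_polys n d"
    and "sigma_represents TYPE(nat) n \<phi> P" "sigma_represents TYPE(nat) n \<phi> Q"
  shows "P = Q"
proof (rule zpoly_eqI[OF finite_depth_vars assms(1,2)[unfolded depth_polys_def]])
  fix c :: "nat \<times> nat \<Rightarrow> complex"
  \<comment> \<open>The row \<open>p i\<close> of the point consists of the power sums belonging to
    the prescribed elementary symmetric functions \<open>c (i, j)\<close>; rows are chosen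
    independently.\<close>
  have "\<exists>a. \<forall>j\<in>{1..d i}. newton_elsym a j = c (i, j)" for i
    using newton_elsym_surj[of "d i" "\<lambda>j. c (i, j)"] by blast
  then obtain p where p: "\<And>i j. j \<in> {1..d i} \<Longrightarrow> newton_elsym (p i) j = c (i, j)"
    by metis
  \<comment> \<open>Both sides equal the value of \<phi> at the generators \<open>mvar i\<close>;
    only now does the choice of the point \<open>p\<close> enter.\<close>
  have "zeval mring (\<lambda>(i, j). msig j (mvar i)) P = zeval mring (\<lambda>(i, j). msig j (mvar i)) Q"
    using assms(3,4) model_mring mring_closed(3) unfolding sigma_represents_def by metis
  moreover have "dec (zeval mring (\<lambda>(i, j). msig j (mvar i)) F) p = zsubst c F" if "F \<in> depth_polys n d" for F
  proof -
    have "dec (zeval mring (\<lambda>(i, j). msig j (mvar i)) F) p =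
        zsubst (\<lambda>v. dec (case v of (i, j) \<Rightarrow> msig j (mvar i)) p) F"
      by (rule dec_zeval) (auto simp: mring_closed split: prod.split)
    also have "\<dots> = zsubst c F"
      by (rule zsubst_cong[OF that[unfolded depth_polys_def]])
        (use p in \<open>auto simp: mring_closed dec_simps fsig_def frob_def\<close>)
    finally show ?thesis .
  qed
  ultimately show "zsubst c P = zsubst c Q"
    using assms(1,2) by metis
qed

lemma lambda_represents_unique:
  assumes "P \<in> depth_polys n d" "Q \<in> depth_polys n d"
    and "lambda_represents TYPE(nat) n \<phi> P" "lambda_represents TYPE(nat) n \<phi> Q"
  shows "P = Q"
proof (rule zpoly_eqI[OF finite_depth_vars assms(1,2)[unfolded depth_polys_def]])
  fix c :: "nat \<times> nat \<Rightarrow> complex"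
  \<comment> \<open>At \<open>p\<close> the \<lambda>-operation of index \<open>j\<close> on a
    generator is \<open>(-1) ^ j\<close> times the recursion applied to the negated row, so both
    signs are built into the prescribed value.\<close>
  have "\<exists>a. \<forall>j\<in>{1..d i}. newton_elsym (\<lambda>k. - a k) j = (-1) ^ j * c (i, j)" for i
  proof -
    obtain a where a: "\<forall>j\<in>{1..d i}. newton_elsym a j = (-1) ^ j * c (i, j)"
      using newton_elsym_surj[of "d i" "\<lambda>j. (-1) ^ j * c (i, j)"] by blast
    then show ?thesis by (intro exI[of _ "\<lambda>k. - a k"]) simp
  qed
  then obtain p where p: "\<And>i j. j \<in> {1..d i} \<Longrightarrow> newton_elsym (\<lambda>k. - p i k) j = (-1) ^ j * c (i, j)"
    by metis
  have "zeval mring (\<lambda>(i, j). mlam j (mvar i)) P = zeval mring (\<lambda>(i, j). mlam j (mvar i)) Q"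
    using assms(3,4) model_mring mring_closed(3) unfolding lambda_represents_def by metis
  moreover have "dec (zeval mring (\<lambda>(i, j). mlam j (mvar i)) F) p = zsubst c F" if "F \<in> depth_polys n d" for F
  proof -
    have "dec (zeval mring (\<lambda>(i, j). mlam j (mvar i)) F) p =
        zsubst (\<lambda>v. dec (case v of (i, j) \<Rightarrow> mlam j (mvar i)) p) F"
      by (rule dec_zeval) (auto simp: mring_closed split: prod.split)
    also have "\<dots> = zsubst c F"
      by (rule zsubst_cong[OF that[unfolded depth_polys_def]])
        (use p in \<open>auto simp: mring_closed dec_simps flam_def fsig_def frob_def simp flip: mult.assoc power_mult_distrib\<close>)
    finally show ?thesis .
  qed
  ultimately show "zsubst c P = zsubst c Q"
    using assms(1,2) by metis
qed

theorem theorem3p7: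
  fixes \<phi> :: lterm and n :: nat and d :: "nat \<Rightarrow> nat"
  assumes "term_in n \<phi>"
    and "\<forall>i\<in>{1..n}. depth \<phi> i = d i"
  shows "(\<exists>P\<in>depth_polys n d.
            lambda_represents TYPE('a) n \<phi> P \<and>
            lambda_represents TYPE(nat) n \<phi> P \<and>
            (\<forall>Q\<in>depth_polys n d. lambda_represents TYPE(nat) n \<phi> Q \<longrightarrow> Q = P)) \<and>
         (\<exists>P\<in>depth_polys n d.
            sigma_represents TYPE('a) n \<phi> P \<and>
            sigma_represents TYPE(nat) n \<phi> P \<and>
            (\<forall>Q\<in>depth_polys n d. sigma_represents TYPE(nat) n \<phi> Q \<longrightarrow> Q = P))"
proof -
  obtain P where P: "P \<in> depth_polys n d" "sigma_represents TYPE('a) n \<phi> P"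
    "sigma_represents TYPE(nat) n \<phi> P"
    using sigma_represents_exists[OF assms, of "TYPE('a)" "TYPE(nat)"] by blast
  let ?L = "zsubst sigma_in_lambda P"
  have L: "?L \<in> depth_polys n d" "lambda_represents TYPE('a) n \<phi> ?L" "lambda_represents TYPE(nat) n \<phi> ?L"
    using P by (auto intro: sigma_in_lambda_in lambda_represents_of_sigma)
  have "\<forall>Q\<in>depth_polys n d. lambda_represents TYPE(nat) n \<phi> Q \<longrightarrow> Q = ?L"
    using lambda_represents_unique L by blast
  moreover have "\<forall>Q\<in>depth_polys n d. sigma_represents TYPE(nat) n \<phi> Q \<longrightarrow> Q = P"
    using sigma_represents_unique P by blast
  ultimately show ?thesis
    using P L by blast
qed

end
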